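(* Let $X$ be a rearrangement invariant space (on $\mathbb{I}=[0,1]$, $\mathbb{I}=[0,\infty)$ or $\mathbb{I}=\mathbb{N}$). Let $F$ and $G$ be two Young functions, with $1<b_F$ so that $G\ominus_1F$ is defined. Suppose that either $X$ is a function space and the triple $(X,F,G)$ is not nice, or $X$ is a sequence space. Then $M(X_F,X_G)=X_{G\ominus_1F}$ (equality as vector spaces, with equivalent norms).
   Context: Banach ideal spaces. Let $\mathbb{I}$ be $[0,1]$ or $[0,\infty)$ with Lebesgue measure, or $\mathbb{N}$ with counting measure, and let $L_0$ be the space of (a.e. equivalence classes of) real- or complex-valued measurable functions on $\mathbb{I}$. A Banach ideal space is a Banach space $X$ that is a linear subspace of $L_0$ such that if $|f|\le|g|$ a.e., $f$ is measurable and $g\in X$, then $f\in X$ and $\|f\|_X\le\|g\|_X$. A rearrangement invariant space is a Banach ideal space $X$ such that (i) if $f\in X$ and $g$ is measurable with $\mu(|f|>\lambda)=\mu(|g|>\lambda)$ for all $\lambda\ge0$, then $g\in X$ and $\|g\|_X=\|f\|_X$; and (ii) (Fatou property) if $0\le f_n\uparrow f$ a.e. with $f_n\in X$ and $\sup_n\|f_n\|_X<\infty$, then $f\in X$ and $\|f\|_X=\sup_n\|f_n\|_X$. It is called a sequence space if $\mathbb{I}=\mathbb{N}$ and a function space otherwise. For a function space, the fundamental function is $\psi_X(t)=\|\mathbf 1_{[0,t)}\|_X$; it "does not vanish at zero" if $\lim_{t\to0^+}\psi_X(t)>0$. Young functions. A Young function is a convex, non-decreasing, left-continuous function $F:[0,\infty)\to[0,\infty]$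 with $F(0)=0$, neither identically $0$ nor identically $\infty$ on $(0,\infty)$. Put $b_F=\sup\{t\ge0: F(t)<\infty\}$. $F$ is called finite if $b_F=\infty$, and is said to jump to infinity if $b_F<\infty$. Truncated generalized Young conjugate. For Young functions $F,G$ and $0<a<b_F$, $(G\ominus_aF)(t)=\sup_{0\le s\le a}\{G(st)-F(s)\}$ for $t\ge0$. Calderón–Lozanovskiĭ spaces. For a Young function $F$ (also for $G\ominus_1F$), $X_F$ is the space of all $f\in L_0$ such that $F(|f|/\lambda)\in X$ for some $\lambda>0$, with norm $\|f\|_{X_F}=\inf\{\lambda>0:\|F(|f|/\lambda)\|_X\le1\}$, where $\|h\|_X=\infty$ if $h\notin X$. Pointwise multipliers. $M(X,Y)=\{f\in L_0: fg\in Y\text{ for all }g\in X\}$ with norm $\|f\|_{M(X,Y)}=\sup_{\|g\|_X=1}\|fg\|_Y$. Nice triple. For a rearrangement invariant function space $X$ and Young functions $F,G$, the triple $(X,F,G)$ is called nice if the following three conditions do not all hold simultaneously: (1) $\psi_X$ does not vanish at zero; (2) $F$ is finite; (3) $G$ jumps to infinity. *)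

theory Defs
  imports "HOL-Analysis.Analysis"
begin

text \<open>
  Elements of \<open>L\<^sub>0\<close> are represented by measurable functions; all notions below are invariant
  under changes on null sets. The scalar sort \<open>{real_normed_field, euclidean_space}\<close> has
  \<open>real\<close> and \<open>complex\<close> as instances, and by Frobenius' theorem these are the only ones
  up to isomorphism. Norms take values in \<open>ennreal\<close>, so that suprema and infima are never
  junk values; on a Banach ideal space the norm is required to be finite.
\<close>

record ('a, 'k) fun_space =
  elems :: "('a \<Rightarrow> 'k) set"
  fnorm :: "('a \<Rightarrow> 'k) \<Rightarrow> ennreal"

text \<open>
  The zero space is excluded: the fundamental function and the supremum over the
  unit sphere in the norm of the multiplier space presuppose nonzero elements.
\<close>

locale banach_ideal_space =
  fixes M :: "'a measure" and X :: "('a, 'k :: {real_normed_field, euclidean_space}) fun_space"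
  assumes elems_measurable: "elems X \<subseteq> borel_measurable M"
    and zero_mem: "(\<lambda>x. 0) \<in> elems X"
    and add_mem: "f \<in> elems X \<Longrightarrow> g \<in> elems X \<Longrightarrow> (\<lambda>x. f x + g x) \<in> elems X"
    and scale_mem: "f \<in> elems X \<Longrightarrow> (\<lambda>x. c * f x) \<in> elems X"
    and norm_finite: "f \<in> elems X \<Longrightarrow> fnorm X f < \<infinity>"
    and norm_eq_0_iff: "f \<in> elems X \<Longrightarrow> fnorm X f = 0 \<longleftrightarrow> (AE x in M. f x = 0)"
    and norm_scale: "f \<in> elems X \<Longrightarrow> fnorm X (\<lambda>x. c * f x) = ennreal (norm c) * fnorm X f"
    and norm_triangle: "f \<in> elems X \<Longrightarrow> g \<in> elems X \<Longrightarrow>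
          fnorm X (\<lambda>x. f x + g x) \<le> fnorm X f + fnorm X g"
    and norm_complete: "(\<And>n::nat. u n \<in> elems X) \<Longrightarrow>
          (\<And>e. e > 0 \<Longrightarrow> \<exists>N. \<forall>m\<ge>N. \<forall>n\<ge>N. fnorm X (\<lambda>x. u m x - u n x) < e) \<Longrightarrow>
          \<exists>f\<in>elems X. (\<lambda>n. fnorm X (\<lambda>x. u n x - f x)) \<longlonglongrightarrow> 0"
    and ideal_mem: "f \<in> borel_measurable M \<Longrightarrow> g \<in> elems X \<Longrightarrow>
          (AE x in M. norm (f x) \<le> norm (g x)) \<Longrightarrow> f \<in> elems X"
    and ideal_norm: "f \<in> borel_measurable M \<Longrightarrow> g \<in> elems X \<Longrightarrow>
          (AE x in M. norm (f x) \<le> norm (g x)) \<Longrightarrow> fnorm X f \<le> fnorm X g"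
    and nontrivial: "\<exists>f\<in>elems X. \<not> (AE x in M. f x = 0)"

definition equimeasurable :: "'a measure \<Rightarrow> ('a \<Rightarrow> 'k::real_normed_vector) \<Rightarrow> ('a \<Rightarrow> 'k) \<Rightarrow> bool" where
  "equimeasurable M f g \<longleftrightarrow>
     (\<forall>l\<ge>0. emeasure M {x \<in> space M. norm (f x) > l} = emeasure M {x \<in> space M. norm (g x) > l})"

locale rearrangement_invariant_space = banach_ideal_space +
  assumes rearrangement_mem: "f \<in> elems X \<Longrightarrow> g \<in> borel_measurable M \<Longrightarrow>
          equimeasurable M f g \<Longrightarrow> g \<in> elems X"
    and rearrangement_norm: "f \<in> elems X \<Longrightarrow> g \<in> borel_measurable M \<Longrightarrow>
          equimeasurable M f g \<Longrightarrow> fnorm X g = fnorm X f"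
    and fatou_mem: "v \<in> borel_measurable M \<Longrightarrow>
          (\<And>n::nat. (\<lambda>x. of_real (u n x)) \<in> elems X) \<Longrightarrow>
          (AE x in M. (\<forall>n. 0 \<le> u n x \<and> u n x \<le> u (Suc n) x) \<and> (\<lambda>n. u n x) \<longlonglongrightarrow> v x) \<Longrightarrow>
          (SUP n. fnorm X (\<lambda>x. of_real (u n x))) < \<infinity> \<Longrightarrow>
          (\<lambda>x. of_real (v x)) \<in> elems X"
    and fatou_norm: "v \<in> borel_measurable M \<Longrightarrow>
          (\<And>n::nat. (\<lambda>x. of_real (u n x)) \<in> elems X) \<Longrightarrow>
          (AE x in M. (\<forall>n. 0 \<le> u n x \<and> u n x \<le> u (Suc n) x) \<and> (\<lambda>n. u n x) \<longlonglongrightarrow> v x) \<Longrightarrow>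
          (SUP n. fnorm X (\<lambda>x. of_real (u n x))) < \<infinity> \<Longrightarrow>
          fnorm X (\<lambda>x. of_real (v x)) = (SUP n. fnorm X (\<lambda>x. of_real (u n x)))"

definition fundamental_function :: "(real, 'k::real_normed_field) fun_space \<Rightarrow> real \<Rightarrow> ennreal" where
  "fundamental_function X t = fnorm X (indicator {0..<t})"

definition nonvanishing_at_zero :: "(real, 'k::real_normed_field) fun_space \<Rightarrow> bool" where
  "nonvanishing_at_zero X \<longleftrightarrow> (\<exists>L>0. (fundamental_function X \<longlongrightarrow> L) (at_right 0))"

text \<open>Only the values of a Young function on \<open>{0..}\<close> are relevant.\<close>

definition young_function :: "(real \<Rightarrow> ennreal) \<Rightarrow> bool" where
  "young_function F \<longleftrightarrow>
     (\<forall>s\<ge>0. \<forall>t\<ge>0. \<forall>u\<in>{0..1}.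
        F (u * s + (1 - u) * t) \<le> ennreal u * F s + ennreal (1 - u) * F t) \<and>
     mono_on {0..} F \<and>
     (\<forall>t>0. continuous (at_left t) F) \<and>
     F 0 = 0 \<and>
     (\<exists>t>0. F t \<noteq> 0) \<and>
     (\<exists>t>0. F t \<noteq> \<infinity>)"

definition young_bound :: "(real \<Rightarrow> ennreal) \<Rightarrow> ereal" where
  "young_bound F = (SUP t\<in>{t. 0 \<le> t \<and> F t < \<infinity>}. ereal t)"

definition young_finite :: "(real \<Rightarrow> ennreal) \<Rightarrow> bool" where
  "young_finite F \<longleftrightarrow> young_bound F = \<infinity>"

definition young_jumps :: "(real \<Rightarrow> ennreal) \<Rightarrow> bool" where
  "young_jumps F \<longleftrightarrow> young_bound F < \<infinity>"

text \<open>
  Subtraction on \<open>ennreal\<close> truncates at \<open>0\<close>. This does not affect the supremum, because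
  \<open>s = 0\<close> contributes \<open>G 0 - F 0 = 0\<close>. If \<open>a\<close> is below the bound of \<open>F\<close>, then \<open>F s\<close> is finite
  and no difference of two infinite values occurs.
\<close>

definition young_conj :: "(real \<Rightarrow> ennreal) \<Rightarrow> real \<Rightarrow> (real \<Rightarrow> ennreal) \<Rightarrow> real \<Rightarrow> ennreal" where
  "young_conj G a F t = (SUP s\<in>{0..a}. G (s * t) - F s)"

text \<open>
  Membership and norm in \<open>X\<close> for a \<open>[0,\<infinity>]\<close>-valued function, which belongs to \<open>L\<^sub>0\<close> only if it
  is finite almost everywhere.
\<close>

definition ext_mem :: "'a measure \<Rightarrow> ('a, 'k::real_normed_field) fun_space \<Rightarrow> ('a \<Rightarrow> ennreal) \<Rightarrow> bool" where
  "ext_mem M X h \<longleftrightarrow> (AE x in M. h x < \<infinity>) \<and> (\<lambda>x. of_real (enn2real (h x))) \<in> elems X"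

definition ext_norm :: "'a measure \<Rightarrow> ('a, 'k::real_normed_field) fun_space \<Rightarrow> ('a \<Rightarrow> ennreal) \<Rightarrow> ennreal" where
  "ext_norm M X h = (if ext_mem M X h then fnorm X (\<lambda>x. of_real (enn2real (h x))) else \<infinity>)"

definition calderon_lozanovskii ::
  "'a measure \<Rightarrow> ('a, 'k::real_normed_field) fun_space \<Rightarrow> (real \<Rightarrow> ennreal) \<Rightarrow> ('a, 'k) fun_space" where
  "calderon_lozanovskii M X F =
     \<lparr>elems = {f \<in> borel_measurable M. \<exists>l>0. ext_mem M X (\<lambda>x. F (norm (f x) / l))},
      fnorm = (\<lambda>f. INF l\<in>{l. 0 < l \<and> ext_norm M X (\<lambda>x. F (norm (f x) / l)) \<le> 1}. ennreal l)\<rparr>"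

definition multipliers ::
  "'a measure \<Rightarrow> ('a, 'k::real_normed_field) fun_space \<Rightarrow> ('a, 'k) fun_space \<Rightarrow> ('a, 'k) fun_space" where
  "multipliers M X Y =
     \<lparr>elems = {f \<in> borel_measurable M. \<forall>g\<in>elems X. (\<lambda>x. f x * g x) \<in> elems Y},
      fnorm = (\<lambda>f. SUP g\<in>{g \<in> elems X. fnorm X g = 1}. fnorm Y (\<lambda>x. f x * g x))\<rparr>"

definition equal_with_equivalent_norms :: "('a, 'k) fun_space \<Rightarrow> ('a, 'k) fun_space \<Rightarrow> bool" where
  "equal_with_equivalent_norms X Y \<longleftrightarrow>
     elems X = elems Y \<and>
     (\<exists>c>0. \<exists>C>0. \<forall>f\<in>elems X.
        ennreal c * fnorm X f \<le> fnorm Y f \<and> fnorm Y f \<le> ennreal C * fnorm X f)"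

definition nice_triple ::
  "(real, 'k::real_normed_field) fun_space \<Rightarrow> (real \<Rightarrow> ennreal) \<Rightarrow> (real \<Rightarrow> ennreal) \<Rightarrow> bool" where
  "nice_triple X F G \<longleftrightarrow> \<not> (nonvanishing_at_zero X \<and> young_finite F \<and> young_jumps G)"

end

theory Submission
  imports Defs
begin

text \<open>
  In both cases \<open>X\<close> embeds into \<open>L\<^sub>\<infinity>\<close>. If \<open>g \<in> X\<^sub>F\<close>, then \<open>g\<close> is bounded and can be rescaled so that
  \<open>|g| \<le> 1\<close>; the Young-type inequality \<open>G (s t) \<le> (G \<ominus>\<^sub>1 F) t + F s\<close> for \<open>s \<le> 1\<close> then gives one
  inclusion. Conversely, the norm of a multiplier \<open>f\<close> is finite by a gliding hump argument. Testing
  \<open>f\<close> against indicators shows that \<open>f\<close> is bounded, so after rescaling \<open>G (|f|)\<close> is as small as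
  desired. Choose \<open>s\<close> measurable with \<open>s \<le> 1\<close> such that \<open>G (s |f|) - F s\<close> nearly attains
  \<open>(G \<ominus>\<^sub>1 F) (|f|)\<close>. Since \<open>F s \<le> G (s |f|)\<close> is uniformly small, exhausting the underlying space by
  blocks shows that \<open>s\<close> lies in the unit ball of \<open>X\<^sub>F\<close>; hence \<open>s f\<close>, and with it
  \<open>(G \<ominus>\<^sub>1 F) (|f|)\<close>, is controlled by the multiplier norm of \<open>f\<close>.
\<close>

section \<open>Measurability of monotone functions and growth of Young functions\<close>

text \<open>Truncation at \<open>n\<close> makes the values finite, so the real-valued result on
  monotone functions applies; the supremum of the truncations recovers \<open>f\<close>, infinite
  values included.\<close>

lemma borel_measurable_mono_ennreal:
  fixes f :: "real \<Rightarrow> ennreal"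
  assumes "mono f"
  shows "f \<in> borel_measurable borel"
proof -
  have "f = (\<lambda>x. SUP n::nat. ennreal (enn2real (min (f x) (of_nat n))))"
  proof
    fix x
    have "(SUP n::nat. min (f x) (of_nat n :: ennreal)) = min (f x) (SUP n::nat. of_nat n)"
      by (simp add: inf_min[symmetric] inf_SUP)
    then show "f x = (SUP n::nat. ennreal (enn2real (min (f x) (of_nat n))))"
      by (simp add: ennreal_SUP_of_nat_eq_top min_less_iff_disj of_nat_less_top)
  qed
  moreover have "(\<lambda>x. enn2real (min (f x) (of_nat n))) \<in> borel_measurable borel" for n :: nat
    using assms by (intro borel_measurable_mono monoI enn2real_mono)
      (auto simp: min_less_iff_disj of_nat_less_top monoD min.coboundedI1)
  ultimately show ?thesis
    by (subst \<open>f = _\<close>) (intro borel_measurable_SUP countableI_type measurable_compose[OF _ measurable_ennreal])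
qed

text \<open>Young functions are constrained on \<open>{0..}\<close> only; precomposing with
  \<open>max 0\<close> gives a function that is monotone on the whole line.\<close>

lemma borel_measurable_mono_on_nonneg:
  fixes F :: "real \<Rightarrow> ennreal"
  assumes "mono_on {0..} F" "u \<in> borel_measurable M" "\<And>x. 0 \<le> u x"
  shows "(\<lambda>x. F (u x)) \<in> borel_measurable M"
proof -
  have "mono (\<lambda>t. F (max 0 t))"
    by (intro monoI mono_onD[OF assms(1)]) auto
  from measurable_compose[OF assms(2) borel_measurable_mono_ennreal[OF this]] show ?thesis
    using assms(3) by (simp add: max_def)
qed

lemma young_mono: "young_function F \<Longrightarrow> mono_on {0..} F"
  by (simp add: young_function_def)

lemma young_monoD: "young_function F \<Longrightarrow> 0 \<le> s \<Longrightarrow> s \<le> t \<Longrightarrow> F s \<le> F t"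
  using mono_onD[OF young_mono] by auto

lemma young_zero: "young_function F \<Longrightarrow> F 0 = 0"
  by (simp add: young_function_def)

text \<open>Convexity between \<open>t\<close> and 0, where \<open>F\<close> vanishes. Convexity of
  Young functions enters the later arguments in this form.\<close>

lemma young_scale:
  assumes "young_function F" "0 \<le> t" "0 \<le> u" "u \<le> 1"
  shows "F (u * t) \<le> ennreal u * F t"
proof -
  have "F (u * t + (1 - u) * 0) \<le> ennreal u * F t + ennreal (1 - u) * F 0"
    using assms unfolding young_function_def by (meson atLeastAtMost_iff order_refl)
  then show ?thesis
    using assms by (simp add: young_zero)
qed

text \<open>Scaling \<open>t\<close> down to a point \<open>t0\<close> with \<open>F t0 > 0\<close>
  shows \<open>F t \<ge> (t / t0) * F t0\<close> for \<open>t > t0\<close>. Growth is thus at least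
  linear, so sublevel sets are bounded. The bound is taken at least 1 so that it can serve as a
  rescaling factor.\<close>

lemma young_level_bounded:
  assumes "young_function F"
  obtains K where "1 \<le> K" "\<And>t. 0 \<le> t \<Longrightarrow> F t \<le> ennreal a \<Longrightarrow> t \<le> K"
proof -
  obtain t0 where t0: "0 < t0" "F t0 \<noteq> 0"
    using assms by (auto simp: young_function_def)
  \<comment> \<open>\<open>F t0\<close> may be infinite, so a finite positive lower bound
    \<open>b\<close> takes its place in the division.\<close>
  obtain b where b: "0 < b" "ennreal b \<le> F t0"
  proof (cases "F t0")
    case (real r)
    then show ?thesis using t0(2) that[of r] by (cases "r = 0") auto
  next
    case top
    then show ?thesis using that[of 1] by simp
  qed
  show ?thesis
  proof (rule that[of "max 1 (max t0 (t0 * max 0 a / b))"])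
    fix t assume t: "0 \<le> t" "F t \<le> ennreal a"
    show "t \<le> max 1 (max t0 (t0 * max 0 a / b))"
    proof (cases "t \<le> t0")
      case False
      then have "F (t0 / t * t) \<le> ennreal (t0 / t) * F t"
        using t0 by (intro young_scale[OF assms]) auto
      also have "\<dots> \<le> ennreal (t0 / t) * ennreal (max 0 a)"
        using t by (intro mult_left_mono) (auto simp: max_def ennreal_neg)
      finally have "F t0 \<le> ennreal (t0 / t) * ennreal (max 0 a)"
        using False t0 by simp
      then have "ennreal b \<le> ennreal (t0 / t * max 0 a)"
        using order_trans[OF b(2)] False t0 by (subst ennreal_mult) auto
      then have "b \<le> t0 / t * max 0 a"
        using False t0 by (subst (asm) ennreal_le_iff) (auto intro!: mult_nonneg_nonneg)
      then have "t \<le> t0 * max 0 a / b"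
        using b False t0 by (simp add: field_simps)
      then show ?thesis by simp
    qed simp
  qed simp
qed

text \<open>Shrinking a point \<open>t0\<close> of finite value \<open>b\<close> by \<open>u\<close>
  shrinks the value at least by \<open>u\<close>. The choice \<open>e / (b + 1)\<close> stays
  meaningful when \<open>b = 0\<close>.\<close>

lemma young_small:
  assumes "young_function F" "0 < e"
  obtains d where "0 < d" "F d \<le> ennreal e"
proof -
  obtain t0 where t0: "0 < t0" "F t0 \<noteq> \<infinity>"
    using assms by (auto simp: young_function_def)
  obtain b where b: "0 \<le> b" "F t0 = ennreal b"
    using t0(2) by (cases "F t0") auto
  define u where "u = min 1 (e / (b + 1))"
  then have u: "0 < u" "u \<le> 1" "u * (b + 1) \<le> e"
    using assms b mult_right_mono[of u "e / (b + 1)" "b + 1"] by (auto simp: u_def)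
  have "F (u * t0) \<le> ennreal u * ennreal b"
    using young_scale[OF assms(1), of t0 u] u t0 b by simp
  also have "\<dots> = ennreal (u * b)"
    using u b by (simp add: ennreal_mult)
  also have "u * b \<le> e"
    using u by (simp add: algebra_simps)
  finally show ?thesis
    using that[of "u * t0"] u t0 by (auto simp: ennreal_leI)
qed

lemma mono_young_conj:
  assumes "young_function G"
  shows "mono_on {0..} (young_conj G a F)"
  unfolding young_conj_def
  by (intro mono_onI SUP_subset_mono)
    (auto intro!: ennreal_minus_mono young_monoD[OF assms] mult_left_mono mult_nonneg_nonneg)

lemma young_conj_ineq:
  assumes "s \<in> {0..a}"
  shows "G (s * t) \<le> young_conj G a F t + F s"
proof -
  \<comment> \<open>Truncated subtraction satisfies \<open>(p - q) + q \<ge> p\<close> for all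
    extended values, so infinite values require no separate case.\<close>
  have "G (s * t) \<le> (G (s * t) - F s) + F s"
    by (simp add: diff_add_self_ennreal not_le less_imp_le)
  also have "G (s * t) - F s \<le> young_conj G a F t"
    using assms unfolding young_conj_def by (intro SUP_upper)
  finally show ?thesis by (simp add: add_right_mono)
qed

section \<open>The norm of \<open>X\<close> on functions with values in
  \<open>[0,\<infinity>]\<close>\<close>

context banach_ideal_space
begin

lemma ext_norm_eq: "ext_mem M X h \<Longrightarrow> ext_norm M X h = fnorm X (\<lambda>x. of_real (enn2real (h x)))"
  by (simp add: ext_norm_def)

text \<open>Elements of \<open>X\<close> have finite norm, so every membership question below turns
  into a norm inequality.\<close>

lemma ext_mem_iff: "ext_mem M X h \<longleftrightarrow> ext_norm M X h < \<infinity>"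
  using norm_finite by (auto simp: ext_norm_def ext_mem_def)

lemma ext_norm_mono_AE:
  assumes [measurable]: "h1 \<in> borel_measurable M" and le: "AE x in M. h1 x \<le> h2 x"
  shows "ext_norm M X h1 \<le> ext_norm M X h2"
proof (cases "ext_mem M X h2")
  case True
  then have fin: "AE x in M. h2 x < \<infinity>" and mem: "(\<lambda>x. of_real (enn2real (h2 x))) \<in> elems X"
    by (auto simp: ext_mem_def)
  have meas: "(\<lambda>x. of_real (enn2real (h1 x)) :: 'k) \<in> borel_measurable M"
    by measurable
  have ae: "AE x in M. norm (of_real (enn2real (h1 x)) :: 'k) \<le> norm (of_real (enn2real (h2 x)) :: 'k)"
    using le fin by eventually_elim (simp add: enn2real_mono)
  have "AE x in M. h1 x < \<infinity>"
    using le fin by eventually_elim auto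
  then have "ext_mem M X h1"
    using ideal_mem[OF meas mem ae] by (simp add: ext_mem_def)
  then show ?thesis
    using True ideal_norm[OF meas mem ae] by (simp add: ext_norm_eq)
qed (simp add: ext_norm_def)

lemma ext_norm_mono:
  "h1 \<in> borel_measurable M \<Longrightarrow> (\<And>x. x \<in> space M \<Longrightarrow> h1 x \<le> h2 x) \<Longrightarrow> ext_norm M X h1 \<le> ext_norm M X h2"
  by (intro ext_norm_mono_AE) auto

lemma ext_norm_zero: "ext_norm M X (\<lambda>x. 0) = 0"
  using norm_eq_0_iff[OF zero_mem] by (simp add: ext_norm_def ext_mem_def zero_mem)

lemma ext_norm_add:
  assumes [measurable]: "h1 \<in> borel_measurable M" "h2 \<in> borel_measurable M"
  shows "ext_norm M X (\<lambda>x. h1 x + h2 x) \<le> ext_norm M X h1 + ext_norm M X h2"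
proof (cases "ext_mem M X h1 \<and> ext_mem M X h2")
  case True
  let ?r = "\<lambda>h x. of_real (enn2real (h x)) :: 'k"
  have fin: "AE x in M. h1 x < \<infinity>" "AE x in M. h2 x < \<infinity>"
    and mem: "?r h1 \<in> elems X" "?r h2 \<in> elems X"
    using True by (auto simp: ext_mem_def)
  have meas: "?r (\<lambda>x. h1 x + h2 x) \<in> borel_measurable M"
    by measurable
  have ae: "AE x in M. norm (?r (\<lambda>x. h1 x + h2 x) x) \<le> norm (?r h1 x + ?r h2 x)"
    using fin by eventually_elim (simp add: enn2real_plus flip: of_real_add)
  have "AE x in M. h1 x + h2 x < \<infinity>"
    using fin by eventually_elim simp
  then have "ext_mem M X (\<lambda>x. h1 x + h2 x)"
    using ideal_mem[OF meas add_mem[OF mem] ae] by (simp add: ext_mem_def)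
  then show ?thesis
    using True ideal_norm[OF meas add_mem[OF mem] ae] norm_triangle[OF mem]
    by (simp add: ext_norm_eq)
next
  case False
  then show ?thesis by (auto simp: ext_norm_def)
qed

lemma ext_norm_sum:
  assumes "\<And>k. h k \<in> borel_measurable M"
  shows "ext_norm M X (\<lambda>x. \<Sum>k<n::nat. h k x) \<le> (\<Sum>k<n. ext_norm M X (h k))"
proof (induction n)
  case (Suc n)
  have "ext_norm M X (\<lambda>x. (\<Sum>k<n. h k x) + h n x) \<le> ext_norm M X (\<lambda>x. \<Sum>k<n. h k x) + ext_norm M X (h n)"
    using assms by (intro ext_norm_add) auto
  also have "\<dots> \<le> (\<Sum>k<n. ext_norm M X (h k)) + ext_norm M X (h n)"
    using Suc by (intro add_right_mono)
  finally show ?case by simp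
qed (simp add: ext_norm_zero)

lemma ext_norm_scale:
  assumes "0 < c"
  shows "ext_norm M X (\<lambda>x. ennreal c * h x) \<le> ennreal c * ext_norm M X h"
proof (cases "ext_mem M X h")
  case True
  then have fin: "AE x in M. h x < \<infinity>" and mem: "(\<lambda>x. of_real (enn2real (h x))) \<in> elems X"
    by (auto simp: ext_mem_def)
  have eq: "(\<lambda>x. of_real (enn2real (ennreal c * h x)) :: 'k) = (\<lambda>x. of_real c * of_real (enn2real (h x)))"
    using assms by (simp add: enn2real_mult)
  have "AE x in M. ennreal c * h x < \<infinity>"
    using fin by eventually_elim (simp add: ennreal_mult_less_top)
  then have "ext_mem M X (\<lambda>x. ennreal c * h x)"
    unfolding ext_mem_def eq using scale_mem[OF mem, of "of_real c"] by simp
  then show ?thesis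
    using True norm_scale[OF mem, of "of_real c"] assms by (simp add: ext_norm_eq eq)
next
  case False
  then show ?thesis using assms by (simp add: ext_norm_def ennreal_mult_top)
qed

end

text \<open>The Fatou property for extended-valued functions. Finiteness almost everywhere is
  assumed because the Fatou property speaks of limits in \<open>L\<^sub>0\<close>; in the
  applications it comes from a uniform pointwise bound on the \<open>h n\<close>.\<close>

lemma (in rearrangement_invariant_space) ext_norm_SUP:
  assumes [measurable]: "\<And>n::nat. h n \<in> borel_measurable M"
    and inc: "\<And>n x. x \<in> space M \<Longrightarrow> h n x \<le> h (Suc n) x"
    and fin: "AE x in M. (SUP n. h n x) < \<infinity>"
    and le: "\<And>n. ext_norm M X (h n) \<le> K" and K: "K < \<infinity>"
  shows "ext_norm M X (\<lambda>x. SUP n. h n x) \<le> K"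
proof -
  let ?u = "\<lambda>n x. enn2real (h n x)" and ?v = "\<lambda>x. enn2real (SUP n. h n x)"
  have mem: "ext_mem M X (h n)" for n
    using le[of n] K by (simp add: ext_mem_iff)
  have bd: "(SUP n. fnorm X (\<lambda>x. of_real (?u n x))) \<le> K"
    using le by (intro SUP_least) (simp add: ext_norm_eq[OF mem])
  have "AE x in M. (\<forall>n. 0 \<le> ?u n x \<and> ?u n x \<le> ?u (Suc n) x) \<and> (\<lambda>n. ?u n x) \<longlonglongrightarrow> ?v x"
    using fin AE_space
  proof eventually_elim
    case (elim x)
    have lt: "h n x < \<infinity>" for n
      using elim(1) by (meson SUP_upper UNIV_I order_le_less_trans)
    have "incseq (\<lambda>n. h n x)"
      using inc[OF elim(2)] by (rule incseq_SucI)
    then have "(\<lambda>n. h n x) \<longlonglongrightarrow> ennreal (?v x)"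
      using LIMSEQ_SUP[of "\<lambda>n. h n x"] elim by simp
    then have "(\<lambda>n. ?u n x) \<longlonglongrightarrow> ?v x"
      by (rule tendsto_enn2real) simp
    then show ?case
      using inc[OF elim(2)] lt by (auto intro!: enn2real_mono)
  qed
  note * = _ _ this order_le_less_trans[OF bd K]
  have v: "?v \<in> borel_measurable M" by measurable
  have u: "(\<lambda>x. of_real (?u n x)) \<in> elems X" for n
    using mem by (simp add: ext_mem_def)
  have "ext_mem M X (\<lambda>x. SUP n. h n x)"
    using fatou_mem[OF *, OF v u] fin by (simp add: ext_mem_def)
  then show ?thesis
    using fatou_norm[OF *, OF v u] bd by (simp add: ext_norm_eq)
qed

section \<open>Modular and Luxemburg norm in Calderon-Lozanovskii spaces\<close>

context banach_ideal_space
begin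

lemma modular_measurable:
  fixes f :: "'a \<Rightarrow> 'k" and F :: "real \<Rightarrow> ennreal"
  assumes "mono_on {0..} F" "f \<in> borel_measurable M" "0 < l"
  shows "(\<lambda>x. F (norm (f x) / l)) \<in> borel_measurable M"
  using assms by (intro borel_measurable_mono_on_nonneg[OF assms(1)]) auto

lemma cl_elems_iff:
  "f \<in> elems (calderon_lozanovskii M X F) \<longleftrightarrow>
    f \<in> borel_measurable M \<and> (\<exists>l>0. ext_norm M X (\<lambda>x. F (norm (f x) / l)) < \<infinity>)"
  by (auto simp: calderon_lozanovskii_def ext_mem_iff)

lemma cl_norm_eq:
  "fnorm (calderon_lozanovskii M X F) f = (INF l\<in>{l. 0 < l \<and> ext_norm M X (\<lambda>x. F (norm (f x) / l)) \<le> 1}. ennreal l)"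
  by (simp add: calderon_lozanovskii_def)

lemma cl_norm_le:
  "0 < l \<Longrightarrow> ext_norm M X (\<lambda>x. F (norm (f x) / l)) \<le> 1 \<Longrightarrow>
    fnorm (calderon_lozanovskii M X F) f \<le> ennreal l"
  by (auto simp: calderon_lozanovskii_def intro!: INF_lower)

text \<open>A strict inequality yields an admissible \<open>k < l\<close>, and monotonicity passes
  from \<open>k\<close> to \<open>l\<close>. Attainment of the infimum is not claimed, which is why
  norm 1 is later used only at scale 2.\<close>

lemma cl_norm_less:
  assumes mono: "mono_on {0..} F" and [measurable]: "f \<in> borel_measurable M"
    and less: "fnorm (calderon_lozanovskii M X F) f < ennreal l"
  shows "ext_norm M X (\<lambda>x. F (norm (f x) / l)) \<le> 1"
proof -
  obtain k where k: "0 < k" "ext_norm M X (\<lambda>x. F (norm (f x) / k)) \<le> 1" "ennreal k < ennreal l"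
    using less by (auto simp: calderon_lozanovskii_def INF_less_iff)
  then have "k < l"
    by (simp add: ennreal_less_iff)
  then have "ext_norm M X (\<lambda>x. F (norm (f x) / l)) \<le> ext_norm M X (\<lambda>x. F (norm (f x) / k))"
    using k mono by (intro ext_norm_mono modular_measurable mono_onD[OF mono]) (auto intro!: divide_left_mono)
  then show ?thesis
    using k(2) by simp
qed

lemma cl_norm_scale_le:
  assumes a: "0 < a"
  shows "fnorm (calderon_lozanovskii M X F) (\<lambda>x. of_real a * f x)
    \<le> ennreal a * fnorm (calderon_lozanovskii M X F) f"
proof -
  let ?n = "fnorm (calderon_lozanovskii M X F) (\<lambda>x. of_real a * f x)"
  have "ennreal (1 / a) * ?n \<le> fnorm (calderon_lozanovskii M X F) f"
    unfolding cl_norm_eq[of F f]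
  proof (rule INF_greatest)
    fix l assume "l \<in> {l. 0 < l \<and> ext_norm M X (\<lambda>x. F (norm (f x) / l)) \<le> 1}"
    then have "?n \<le> ennreal (a * l)"
      using a by (intro cl_norm_le) (auto simp: norm_mult)
    then have "ennreal (1 / a) * ?n \<le> ennreal (1 / a) * ennreal (a * l)"
      by (rule mult_left_mono) simp
    also have "\<dots> = ennreal l"
      using a by (simp add: ennreal_mult'[symmetric])
    finally show "ennreal (1 / a) * ?n \<le> ennreal l" .
  qed
  then have "ennreal a * (ennreal (1 / a) * ?n) \<le> ennreal a * fnorm (calderon_lozanovskii M X F) f"
    by (rule mult_left_mono) simp
  then show ?thesis
    using a by (simp add: mult.assoc[symmetric] ennreal_mult'[symmetric])
qed

text \<open>The reverse inequality is \<open>cl_norm_scale_le\<close> for the factor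
  \<open>1 / a\<close>. Membership of \<open>f\<close> is not presupposed; both sides may be
  infinite.\<close>

lemma cl_norm_scale:
  assumes a: "0 < a"
  shows "fnorm (calderon_lozanovskii M X F) (\<lambda>x. of_real a * f x)
    = ennreal a * fnorm (calderon_lozanovskii M X F) f"
proof (rule antisym)
  have "fnorm (calderon_lozanovskii M X F) (\<lambda>x. of_real (1 / a) * (of_real a * f x))
    \<le> ennreal (1 / a) * fnorm (calderon_lozanovskii M X F) (\<lambda>x. of_real a * f x)"
    using a by (intro cl_norm_scale_le) simp
  moreover have "(\<lambda>x. of_real (1 / a) * (of_real a * f x)) = f"
    using a by (simp add: mult.assoc[symmetric] flip: of_real_mult)
  ultimately have "ennreal a * fnorm (calderon_lozanovskii M X F) f
    \<le> ennreal a * (ennreal (1 / a) * fnorm (calderon_lozanovskii M X F) (\<lambda>x. of_real a * f x))"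
    by (intro mult_left_mono) auto
  then show "ennreal a * fnorm (calderon_lozanovskii M X F) f
    \<le> fnorm (calderon_lozanovskii M X F) (\<lambda>x. of_real a * f x)"
    using a by (simp add: mult.assoc[symmetric] ennreal_mult'[symmetric])
qed (rule cl_norm_scale_le[OF a])

text \<open>\<open>young_scale\<close> applied under the norm. It trades a larger scale for a
  smaller modular and so absorbs constants in modular estimates.\<close>

lemma modular_scale:
  fixes f :: "'a \<Rightarrow> 'k"
  assumes F: "young_function F" and [measurable]: "f \<in> borel_measurable M"
    and l: "0 < l" and u: "1 \<le> u"
  shows "ext_norm M X (\<lambda>x. F (norm (f x) / (u * l))) \<le> ennreal (1 / u) * ext_norm M X (\<lambda>x. F (norm (f x) / l))"
proof -
  have "ext_norm M X (\<lambda>x. F (norm (f x) / (u * l))) \<le> ext_norm M X (\<lambda>x. ennreal (1 / u) * F (norm (f x) / l))"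
  proof (rule ext_norm_mono)
    show "(\<lambda>x. F (norm (f x) / (u * l))) \<in> borel_measurable M"
      using l u by (intro modular_measurable young_mono[OF F]) auto
    fix x
    have "F (1 / u * (norm (f x) / l)) \<le> ennreal (1 / u) * F (norm (f x) / l)"
      using l u by (intro young_scale[OF F]) auto
    then show "F (norm (f x) / (u * l)) \<le> ennreal (1 / u) * F (norm (f x) / l)"
      by simp
  qed
  also have "\<dots> \<le> ennreal (1 / u) * ext_norm M X (\<lambda>x. F (norm (f x) / l))"
    using u by (intro ext_norm_scale) simp
  finally show ?thesis .
qed

lemma cl_normalize:
  assumes F: "young_function F" and f: "f \<in> elems (calderon_lozanovskii M X F)"
  obtains l where "0 < l" "ext_norm M X (\<lambda>x. F (norm (f x) / l)) \<le> 1"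
proof -
  obtain l where l: "0 < l" "ext_norm M X (\<lambda>x. F (norm (f x) / l)) < \<infinity>" and [measurable]: "f \<in> borel_measurable M"
    using f by (auto simp: cl_elems_iff)
  obtain k where k: "0 \<le> k" "ext_norm M X (\<lambda>x. F (norm (f x) / l)) = ennreal k"
    using l(2) by (cases "ext_norm M X (\<lambda>x. F (norm (f x) / l))") auto
  have "ext_norm M X (\<lambda>x. F (norm (f x) / (max 1 k * l))) \<le> ennreal (1 / max 1 k) * ennreal k"
    using modular_scale[OF F _ l(1), of f "max 1 k"] k by simp
  also have "\<dots> \<le> 1"
    using k by (simp add: ennreal_mult'[symmetric])
  finally show ?thesis
    using l by (intro that[of "max 1 k * l"]) auto
qed

end

text \<open>
  The only properties of \<open>X\<close> that the factorization argument needs: \<open>X\<close> embeds into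
  \<open>L\<^sub>\<infinity>\<close>, and the underlying space is covered by a sequence of sets whose
  indicators are bounded in \<open>X\<close>.
\<close>

locale block_bounded_space = rearrangement_invariant_space M X
  for M :: "'a measure" and X :: "('a, 'k :: {real_normed_field, euclidean_space}) fun_space" +
  fixes C D :: real and B :: "nat \<Rightarrow> 'a set"
  assumes C_pos: "0 < C" and D_pos: "0 < D"
    and sup_bound: "f \<in> elems X \<Longrightarrow> AE x in M. ennreal (norm (f x)) \<le> ennreal C * fnorm X f"
    and block_sets: "B n \<in> sets M"
    and block_cover: "(\<Union>n. B n) = space M"
    and block_mem: "indicator (B n) \<in> elems X"
    and block_norm: "fnorm X (indicator (B n)) \<le> ennreal D"
begin

section \<open>Pointwise bounds from the embedding into \<open>L\<^sub>\<infinity>\<close>\<close>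

lemma ext_sup_bound:
  assumes "ext_norm M X h \<le> ennreal K"
  shows "AE x in M. h x \<le> ennreal (C * K)"
proof -
  have mem: "ext_mem M X h"
    using assms by (simp add: ext_mem_iff le_less_trans)
  then have fin: "AE x in M. h x < \<infinity>" and el: "(\<lambda>x. of_real (enn2real (h x))) \<in> elems X"
    by (auto simp: ext_mem_def)
  from sup_bound[OF el] fin show ?thesis
  proof eventually_elim
    case (elim x)
    then have "h x \<le> ennreal C * ext_norm M X h"
      by (simp add: ext_norm_eq[OF mem])
    also have "\<dots> \<le> ennreal C * ennreal K"
      using assms by (intro mult_left_mono) auto
    finally show ?case
      using C_pos by (simp add: ennreal_mult')
  qed
qed

lemma ext_norm_block: "ext_norm M X (indicator (B n)) \<le> ennreal D"
proof -
  have "(\<lambda>x. of_real (enn2real (indicator (B n) x)) :: 'k) = indicator (B n)"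
    by (auto simp: indicator_def)
  then show ?thesis
    using block_mem[of n] block_norm[of n] by (simp add: ext_norm_def ext_mem_def indicator_def)
qed

text \<open>The embedding turns the modular bound into \<open>F (norm (f x) / l) \<le> C * a\<close>
  almost everywhere, and sublevel sets of \<open>F\<close> are bounded. The constant
  \<open>K\<close> depends neither on \<open>f\<close> nor on \<open>l\<close>.\<close>

lemma modular_bounded:
  assumes F: "young_function F"
  obtains K where "1 \<le> K"
    "\<And>f l. 0 < l \<Longrightarrow> ext_norm M X (\<lambda>x. F (norm (f x :: 'k) / l)) \<le> ennreal a \<Longrightarrow> AE x in M. norm (f x) \<le> K * l"
proof -
  obtain K where K: "1 \<le> K" "\<And>t. 0 \<le> t \<Longrightarrow> F t \<le> ennreal (C * a) \<Longrightarrow> t \<le> K"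
    using young_level_bounded[OF F] by metis
  show ?thesis
  proof (rule that[OF K(1)])
    fix f :: "'a \<Rightarrow> 'k" and l :: real
    assume l: "0 < l" and "ext_norm M X (\<lambda>x. F (norm (f x) / l)) \<le> ennreal a"
    from ext_sup_bound[OF this(2)] show "AE x in M. norm (f x) \<le> K * l"
    proof eventually_elim
      case (elim x)
      with K(2)[of "norm (f x) / l"] l show ?case
        by (simp add: divide_le_eq)
    qed
  qed
qed

section \<open>From the conjugate space into the multipliers\<close>

text \<open>Division by \<open>K * m\<close> brings \<open>norm (g x)\<close> into
  \<open>[0,1]\<close>, the range of \<open>s\<close> in the truncated conjugate, so the Young-type
  inequality applies pointwise.\<close>

lemma product_modular:
  fixes f g :: "'a \<Rightarrow> 'k"
  assumes F: "young_function F" and G: "young_function G"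
    and [measurable]: "f \<in> borel_measurable M" "g \<in> borel_measurable M"
    and pos: "0 < l" "0 < m" "1 \<le> K" and bd: "AE x in M. norm (g x) \<le> K * m"
  shows "ext_norm M X (\<lambda>x. G (norm (f x * g x) / (K * l * m)))
    \<le> ext_norm M X (\<lambda>x. young_conj G 1 F (norm (f x) / l)) + ext_norm M X (\<lambda>x. F (norm (g x) / m))"
proof -
  have [measurable]: "(\<lambda>x. young_conj G 1 F (norm (f x) / l)) \<in> borel_measurable M"
    "(\<lambda>x. F (norm (g x) / m)) \<in> borel_measurable M"
    "(\<lambda>x. G (norm (f x * g x) / (K * l * m))) \<in> borel_measurable M"
    using pos by (auto intro!: modular_measurable[OF mono_young_conj[OF G]]
        modular_measurable[OF young_mono[OF F]] modular_measurable[OF young_mono[OF G]])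
  have "ext_norm M X (\<lambda>x. G (norm (f x * g x) / (K * l * m)))
    \<le> ext_norm M X (\<lambda>x. young_conj G 1 F (norm (f x) / l) + F (norm (g x) / m))"
  proof (rule ext_norm_mono_AE)
    from bd show "AE x in M. G (norm (f x * g x) / (K * l * m))
        \<le> young_conj G 1 F (norm (f x) / l) + F (norm (g x) / m)"
    proof eventually_elim
      case (elim x)
      let ?s = "norm (g x) / (K * m)"
      have "G (?s * (norm (f x) / l)) \<le> young_conj G 1 F (norm (f x) / l) + F ?s"
        using elim pos by (intro young_conj_ineq) (auto simp: divide_le_eq)
      \<comment> \<open>Since \<open>K \<ge> 1\<close>, the extra division by \<open>K\<close> only
        decreases the argument of \<open>F\<close>.\<close>
      also have "F ?s \<le> F (norm (g x) / m)"
        using pos by (intro young_monoD[OF F]) (auto intro!: divide_left_mono)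
      finally show ?case
        by (simp add: norm_mult add_left_mono mult.commute mult.left_commute)
    qed
  qed measurable
  also have "\<dots> \<le> ext_norm M X (\<lambda>x. young_conj G 1 F (norm (f x) / l)) + ext_norm M X (\<lambda>x. F (norm (g x) / m))"
    by (rule ext_norm_add) measurable
  finally show ?thesis .
qed

lemma cl_conj_subset_multipliers:
  assumes F: "young_function F" and G: "young_function G"
  shows "elems (calderon_lozanovskii M X (young_conj G 1 F))
    \<subseteq> elems (multipliers M (calderon_lozanovskii M X F) (calderon_lozanovskii M X G))"
proof
  fix f assume f: "f \<in> elems (calderon_lozanovskii M X (young_conj G 1 F))"
  then obtain l where l: "0 < l" "ext_norm M X (\<lambda>x. young_conj G 1 F (norm (f x) / l)) < \<infinity>"
    and fm [measurable]: "f \<in> borel_measurable M"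
    by (auto simp: cl_elems_iff)
  have "(\<lambda>x. f x * g x) \<in> elems (calderon_lozanovskii M X G)"
    if g: "g \<in> elems (calderon_lozanovskii M X F)" for g
  proof -
    have gm [measurable]: "g \<in> borel_measurable M"
      using g by (simp add: cl_elems_iff)
    obtain m where m: "0 < m" "ext_norm M X (\<lambda>x. F (norm (g x) / m)) \<le> 1"
      using cl_normalize[OF F g] .
    obtain K where K: "1 \<le> K" "AE x in M. norm (g x) \<le> K * m"
      using modular_bounded[OF F, of 1] m by (metis ennreal_1)
    have "ext_norm M X (\<lambda>x. G (norm (f x * g x) / (K * l * m))) < \<infinity>"
      using product_modular[OF F G fm gm l(1) m(1) K] l(2) m(2)
      by (auto elim!: le_less_trans intro: le_less_trans simp: ennreal_add_eq_top)
    moreover have "0 < K * l * m"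
      using K l m by simp
    ultimately show ?thesis
      by (auto simp: cl_elems_iff)
  qed
  then show "f \<in> elems (multipliers M (calderon_lozanovskii M X F) (calderon_lozanovskii M X G))"
    by (simp add: multipliers_def)
qed

lemma multiplier_norm_le_cl_conj:
  assumes F: "young_function F" and G: "young_function G"
  obtains c where "0 < c" "\<And>f. f \<in> borel_measurable M \<Longrightarrow>
    ennreal c * fnorm (multipliers M (calderon_lozanovskii M X F) (calderon_lozanovskii M X G)) f
      \<le> fnorm (calderon_lozanovskii M X (young_conj G 1 F)) f"
proof -
  obtain K where K: "1 \<le> K"
    "\<And>f l. 0 < l \<Longrightarrow> ext_norm M X (\<lambda>x. F (norm (f x :: 'k) / l)) \<le> ennreal 1 \<Longrightarrow> AE x in M. norm (f x) \<le> K * l"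
    using modular_bounded[OF F, of 1] by metis
  show ?thesis
  \<comment> \<open>\<open>K\<close> brings the test function into \<open>[0,1]\<close>. One factor
    2 appears because norm 1 controls the modular of \<open>g / 2\<close>, the other because the sum
    of two modulars, at most 2, has to be brought down to 1.\<close>
  proof (rule that[of "1 / (4 * K)"])
    show "0 < 1 / (4 * K)" using K by simp
    fix f :: "'a \<Rightarrow> 'k" assume fm [measurable]: "f \<in> borel_measurable M"
    let ?n = "fnorm (multipliers M (calderon_lozanovskii M X F) (calderon_lozanovskii M X G)) f"
    show "ennreal (1 / (4 * K)) * ?n \<le> fnorm (calderon_lozanovskii M X (young_conj G 1 F)) f"
      unfolding cl_norm_eq[of "young_conj G 1 F"]
    proof (rule INF_greatest)
      fix l assume "l \<in> {l. 0 < l \<and> ext_norm M X (\<lambda>x. young_conj G 1 F (norm (f x) / l)) \<le> 1}"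
      then have l: "0 < l" "ext_norm M X (\<lambda>x. young_conj G 1 F (norm (f x) / l)) \<le> 1"
        by auto
      have "?n \<le> ennreal (4 * K * l)"
        unfolding multipliers_def fun_space.simps(2)
      proof (rule SUP_least)
        fix g assume "g \<in> {g \<in> elems (calderon_lozanovskii M X F). fnorm (calderon_lozanovskii M X F) g = 1}"
        then have gm [measurable]: "g \<in> borel_measurable M" and g: "fnorm (calderon_lozanovskii M X F) g = 1"
          by (auto simp: cl_elems_iff)
        have g2: "ext_norm M X (\<lambda>x. F (norm (g x) / 2)) \<le> 1"
          using g by (intro cl_norm_less young_mono[OF F]) auto
        then have "AE x in M. norm (g x) \<le> K * 2"
          using K(2)[of 2 g] by simp
        then have "ext_norm M X (\<lambda>x. G (norm (f x * g x) / (K * l * 2)))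
          \<le> ext_norm M X (\<lambda>x. young_conj G 1 F (norm (f x) / l)) + ext_norm M X (\<lambda>x. F (norm (g x) / 2))"
          using K l by (intro product_modular[OF F G]) auto
        also have "\<dots> \<le> 1 + 1"
          using l g2 by (intro add_mono)
        finally have "ext_norm M X (\<lambda>x. G (norm (f x * g x) / (K * l * 2))) \<le> 2"
          by simp
        then have "ennreal (1 / 2) * ext_norm M X (\<lambda>x. G (norm (f x * g x) / (K * l * 2))) \<le> ennreal (1 / 2) * ennreal 2"
          by (intro mult_left_mono) auto
        then have "ext_norm M X (\<lambda>x. G (norm (f x * g x) / (2 * (K * l * 2)))) \<le> ennreal (1 / 2) * ennreal 2"
          using K l by (intro order_trans[OF modular_scale[OF G]]) auto
        also have "\<dots> = 1"
          by (simp del: ennreal_half ennreal_numeral flip: ennreal_mult')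
        finally have "fnorm (calderon_lozanovskii M X G) (\<lambda>x. f x * g x) \<le> ennreal (2 * (K * l * 2))"
          using K l by (intro cl_norm_le) auto
        then show "fnorm (calderon_lozanovskii M X G) (\<lambda>x. f x * g x) \<le> ennreal (4 * K * l)"
          by (simp add: algebra_simps)
      qed
      then have "ennreal (1 / (4 * K)) * ?n \<le> ennreal (1 / (4 * K)) * ennreal (4 * K * l)"
        by (intro mult_left_mono) auto
      also have "\<dots> = ennreal l"
        using K by (simp flip: ennreal_mult')
      finally show "ennreal (1 / (4 * K)) * ?n \<le> ennreal l" .
    qed
  qed
qed

section \<open>Multipliers seen through the modular, and finiteness of their norm\<close>

text \<open>The multiplier norm tests only the unit sphere, so \<open>g\<close> has to be
  normalized. If its norm is 0, every scale \<open>1 / (n + 1)\<close> is admissible and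
  \<open>g\<close> vanishes almost everywhere. Otherwise its norm \<open>p\<close> is at most 1, and
  \<open>g / p\<close> lies on the sphere and dominates \<open>g\<close>.\<close>

lemma multiplier_modular:
  assumes F: "young_function F" and G: "young_function G"
    and fm [measurable]: "f \<in> borel_measurable M" and gm [measurable]: "g \<in> borel_measurable M"
    and less: "fnorm (multipliers M (calderon_lozanovskii M X F) (calderon_lozanovskii M X G)) f < ennreal c"
    and c: "0 < c" and g1: "ext_norm M X (\<lambda>x. F (norm (g x))) \<le> 1"
  shows "ext_norm M X (\<lambda>x. G (norm (f x * g x) / c)) \<le> 1"
proof -
  define r where "r = fnorm (calderon_lozanovskii M X F) g"
  have r1: "r \<le> ennreal 1"
    unfolding r_def using g1 by (intro cl_norm_le) auto
  have meas: "(\<lambda>x. G (norm (f x * g x) / c)) \<in> borel_measurable M"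
    using c by (intro modular_measurable young_mono[OF G]) auto
  show ?thesis
  proof (cases "r = 0")
    case True
    obtain K where K: "1 \<le> K"
      "\<And>f l. 0 < l \<Longrightarrow> ext_norm M X (\<lambda>x. F (norm (f x :: 'k) / l)) \<le> ennreal 1 \<Longrightarrow> AE x in M. norm (f x) \<le> K * l"
      using modular_bounded[OF F, of 1] by metis
    have "AE x in M. norm (g x) \<le> K * (1 / real (Suc n))" for n
    proof (rule K(2))
      show "ext_norm M X (\<lambda>x. F (norm (g x) / (1 / real (Suc n)))) \<le> ennreal 1"
        using True unfolding r_def ennreal_1 by (intro cl_norm_less young_mono[OF F]) auto
    qed simp
    then have "AE x in M. \<forall>n. norm (g x) \<le> K * (1 / real (Suc n))"
      by (simp add: AE_all_countable)
    then have "AE x in M. G (norm (f x * g x) / c) \<le> 0"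
    proof eventually_elim
      case (elim x)
      have "(\<lambda>n. K * (1 / real (Suc n))) \<longlonglongrightarrow> K * 0"
        using LIMSEQ_inverse_real_of_nat by (intro tendsto_mult_left) (simp add: inverse_eq_divide)
      then have "norm (g x) \<le> K * 0"
        by (rule LIMSEQ_le_const) (use elim in auto)
      then show ?case
        using young_zero[OF G] by simp
    qed
    then have "ext_norm M X (\<lambda>x. G (norm (f x * g x) / c)) \<le> ext_norm M X (\<lambda>x. 0)"
      by (intro ext_norm_mono_AE meas)
    then show ?thesis
      by (simp add: ext_norm_zero)
  next
    case False
    then obtain p where p: "r = ennreal p" "0 < p" "p \<le> 1"
      using r1 by (cases r) (auto simp: top_unique less_le)
    define g' where "g' x = of_real (1 / p) * g x" for x
    have [measurable]: "g' \<in> borel_measurable M"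
      unfolding g'_def by measurable
    have "fnorm (calderon_lozanovskii M X F) g' = ennreal (1 / p) * r"
      unfolding g'_def r_def using p by (intro cl_norm_scale) simp
    then have n1: "fnorm (calderon_lozanovskii M X F) g' = 1"
      using p by (simp flip: ennreal_mult')
    have "norm (g' x) / (1 / p) = norm (g x)" for x
      using p by (simp add: g'_def norm_mult norm_divide)
    then have "ext_norm M X (\<lambda>x. F (norm (g' x) / (1 / p))) < \<infinity>"
      using g1 by (simp add: le_less_trans)
    then have "g' \<in> elems (calderon_lozanovskii M X F)"
      using p by (auto simp: cl_elems_iff intro!: exI[of _ "1 / p"])
    then have "fnorm (calderon_lozanovskii M X G) (\<lambda>x. f x * g' x)
      \<le> fnorm (multipliers M (calderon_lozanovskii M X F) (calderon_lozanovskii M X G)) f"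
      unfolding multipliers_def fun_space.simps(2) using n1 by (intro SUP_upper) auto
    then have "ext_norm M X (\<lambda>x. G (norm (f x * g' x) / c)) \<le> 1"
      using less by (intro cl_norm_less young_mono[OF G]) auto
    moreover have "ext_norm M X (\<lambda>x. G (norm (f x * g x) / c)) \<le> ext_norm M X (\<lambda>x. G (norm (f x * g' x) / c))"
    proof (rule ext_norm_mono[OF meas])
      fix x
      have "norm (g x) * 1 \<le> norm (g x) * (1 / p)"
        using p by (intro mult_left_mono) auto
      then have "norm (f x) * norm (g x) \<le> norm (f x) * norm (g' x)"
        using p by (intro mult_left_mono) (auto simp: g'_def norm_mult norm_divide)
      then show "G (norm (f x * g x) / c) \<le> G (norm (f x * g' x) / c)"
        using c by (intro young_monoD[OF G]) (auto simp: norm_mult divide_right_mono)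
    qed
    ultimately show ?thesis by simp
  qed
qed

text \<open>A single element of the space dominates all \<open>g k\<close> up to geometric factors.
  It is half the supremum of the weighted functions \<open>w k * norm (g k x) / 2\<close>; its
  modular is bounded by that of the series \<open>\<Sum>k. w k * F (norm (g k x) / 2)\<close>, which
  the triangle inequality and the Fatou property keep at most 1.\<close>

lemma gliding_hump_majorant:
  assumes F: "young_function F"
    and gm [measurable]: "\<And>k. g k \<in> borel_measurable M"
    and g1: "\<And>k. ext_norm M X (\<lambda>x. F (norm (g k x :: 'k) / 2)) \<le> 1"
  obtains u :: "'a \<Rightarrow> 'k" where "u \<in> elems (calderon_lozanovskii M X F)"
    "\<And>k. AE x in M. norm (g k x) \<le> 2 ^ (k + 3) * norm (u x)"
proof -
  define w where "w k = (1 / 2 :: real) ^ Suc k" for k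
  have w: "0 < w k" "w k \<le> 1" for k
    by (auto simp: w_def power_le_one simp flip: power_Suc)
  have sum_w: "(\<Sum>k<n. w k) = 1 - (1 / 2) ^ n" for n
    by (induction n) (auto simp: w_def)
  have sum_w1: "(\<Sum>k<n. ennreal (w k)) \<le> 1" for n
    using w by (subst sum_ennreal) (auto simp: sum_w less_imp_le)
  define p where "p n x = (\<Sum>k<n. ennreal (w k) * F (norm (g k x) / 2))" for n x
  have Fm [measurable]: "(\<lambda>x. F (norm (g k x) / 2)) \<in> borel_measurable M" for k
    by (intro modular_measurable young_mono[OF F]) auto
  have pm [measurable]: "p n \<in> borel_measurable M" for n
    unfolding p_def by measurable
  have p_le: "ext_norm M X (p n) \<le> 1" for n
  proof -
    have "ext_norm M X (p n) \<le> (\<Sum>k<n. ext_norm M X (\<lambda>x. ennreal (w k) * F (norm (g k x) / 2)))"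
      unfolding p_def by (rule ext_norm_sum) measurable
    also have "\<dots> \<le> (\<Sum>k<n. ennreal (w k) * 1)"
      using g1 w by (intro sum_mono order_trans[OF ext_norm_scale] mult_left_mono) auto
    finally show ?thesis
      using sum_w1[of n] by simp
  qed
  have "AE x in M. F (norm (g k x) / 2) \<le> ennreal C" for k
    using ext_sup_bound[of _ 1, OF g1[of k, folded ennreal_1]] by simp
  then have Fbd: "AE x in M. \<forall>k. F (norm (g k x) / 2) \<le> ennreal C"
    by (simp add: AE_all_countable)
  then have "AE x in M. (SUP n. p n x) < \<infinity>"
  proof eventually_elim
    case (elim x)
    have "p n x \<le> ennreal C" for n
    proof -
      have "p n x \<le> (\<Sum>k<n. ennreal (w k) * ennreal C)"
        unfolding p_def using elim by (intro sum_mono mult_left_mono) auto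
      also have "\<dots> \<le> 1 * ennreal C"
        unfolding sum_distrib_right[symmetric] using sum_w1 by (intro mult_right_mono) auto
      finally show ?thesis by simp
    qed
    then have "(SUP n. p n x) \<le> ennreal C"
      by (intro SUP_least)
    then show ?case
      by (simp add: le_less_trans)
  qed
  moreover have "p n x \<le> p (Suc n) x" for n x
    by (simp add: p_def)
  ultimately have sup_p: "ext_norm M X (\<lambda>x. SUP n. p n x) \<le> 1"
    using p_le by (intro ext_norm_SUP pm) auto
  define s where "s x = (SUP k. ennreal (w k * (norm (g k x) / 2)))" for x
  have sm [measurable]: "s \<in> borel_measurable M"
    unfolding s_def by measurable
  \<comment> \<open>Half of a positive finite supremum lies strictly below some term, which gives
    the bound \<open>Fu\<close> without attainment. Where the supremum is infinite,
    \<open>enn2real\<close> gives 0, and \<open>Fu\<close> still holds.\<close>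
  define u :: "'a \<Rightarrow> 'k" where "u x = of_real (enn2real (s x) / 2)" for x
  have um [measurable]: "u \<in> borel_measurable M"
    unfolding u_def by measurable
  have Fu: "F (norm (u x)) \<le> (SUP n. p n x)" for x
  proof (cases "enn2real (s x) = 0")
    case False
    let ?y = "enn2real (s x) / 2"
    have y: "0 < ?y" "s x < \<infinity>"
      using False enn2real_positive_iff[of "s x"] by (auto simp: less_le)
    have "ennreal ?y < ennreal (enn2real (s x))"
      using y(1) by (intro ennreal_lessI) linarith+
    also have "\<dots> = s x"
      using y by simp
    finally obtain k where "ennreal ?y < ennreal (w k * (norm (g k x) / 2))"
      unfolding s_def less_SUP_iff by auto
    then have "?y < w k * (norm (g k x) / 2)"
      using y by (subst (asm) ennreal_less_iff) auto
    then have "F ?y \<le> F (w k * (norm (g k x) / 2))"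
      using y(1) by (intro young_monoD[OF F]) linarith+
    also have "\<dots> \<le> ennreal (w k) * F (norm (g k x) / 2)"
      using w[of k] by (intro young_scale[OF F]) auto
    also have "\<dots> \<le> p (Suc k) x"
      by (simp add: p_def)
    also have "\<dots> \<le> (SUP n. p n x)"
      by (rule SUP_upper) simp
    finally show ?thesis
      by (simp add: u_def)
  qed (simp add: u_def young_zero[OF F])
  have "ext_norm M X (\<lambda>x. F (norm (u x))) \<le> ext_norm M X (\<lambda>x. SUP n. p n x)"
    using modular_measurable[OF young_mono[OF F] um, of 1] Fu by (intro ext_norm_mono) auto
  then have "ext_norm M X (\<lambda>x. F (norm (u x) / 1)) < \<infinity>"
    using sup_p by (simp add: le_less_trans)
  then have "u \<in> elems (calderon_lozanovskii M X F)"
    unfolding cl_elems_iff using um zero_less_one by blast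
  moreover have "AE x in M. norm (g k x) \<le> 2 ^ (k + 3) * norm (u x)" for k
  proof -
    obtain K where K: "1 \<le> K"
      "\<And>f l. 0 < l \<Longrightarrow> ext_norm M X (\<lambda>x. F (norm (f x :: 'k) / l)) \<le> ennreal 1 \<Longrightarrow> AE x in M. norm (f x) \<le> K * l"
      using modular_bounded[OF F, of 1] by metis
    have "AE x in M. norm (g j x) \<le> K * 2" for j
      using K(2)[of 2 "g j"] g1 by simp
    then have "AE x in M. \<forall>j. norm (g j x) \<le> K * 2"
      by (simp add: AE_all_countable)
    then show ?thesis
    proof eventually_elim
      case (elim x)
      \<comment> \<open>The uniform bound on the \<open>g j\<close> makes \<open>s\<close> finite
        almost everywhere, so there \<open>enn2real\<close> keeps its value. The exponent
        \<open>k + 3\<close> collects \<open>1 / w k = 2 ^ Suc k\<close>, the division of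
        \<open>g k\<close> by 2 and the halving in \<open>u\<close>.\<close>
      have "s x \<le> ennreal K"
        unfolding s_def
      proof (intro SUP_least ennreal_leI)
        fix j
        have "w j * (norm (g j x) / 2) \<le> 1 * K"
          using w[of j] elim by (intro mult_mono) (auto simp: mult.commute)
        then show "w j * (norm (g j x) / 2) \<le> K" by simp
      qed
      then have "s x < top"
        by (simp add: le_less_trans)
      have "ennreal (w k * (norm (g k x) / 2)) \<le> s x"
        unfolding s_def by (intro SUP_upper) simp
      then have "w k * (norm (g k x) / 2) \<le> enn2real (s x)"
        using enn2real_mono[OF _ \<open>s x < top\<close>] w[of k] by (metis divide_nonneg_nonneg enn2real_ennreal
            less_imp_le mult_nonneg_nonneg norm_ge_zero zero_le_numeral)
      then have "norm (g k x) \<le> 2 ^ Suc k * (2 * enn2real (s x))"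
        by (simp add: w_def power_divide field_simps)
      then show ?case
        by (simp add: u_def power_add mult_ac)
    qed
  qed
  ultimately show ?thesis by (rule that)
qed

text \<open>An infinite norm provides \<open>g k\<close> on the unit sphere with products of norm
  above \<open>4 ^ k\<close>. Their common majorant \<open>u\<close> is multiplied into
  \<open>X_G\<close>, which bounds these norms by \<open>2 ^ (k + 3) * l\<close> with
  \<open>l\<close> fixed; this fails for large \<open>k\<close>.\<close>

lemma multiplier_norm_finite:
  assumes F: "young_function F" and G: "young_function G"
    and f: "f \<in> elems (multipliers M (calderon_lozanovskii M X F) (calderon_lozanovskii M X G))"
  shows "fnorm (multipliers M (calderon_lozanovskii M X F) (calderon_lozanovskii M X G)) f < \<infinity>"
proof (rule ccontr)
  have fm [measurable]: "f \<in> borel_measurable M"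
    and mult: "\<And>g. g \<in> elems (calderon_lozanovskii M X F) \<Longrightarrow> (\<lambda>x. f x * g x) \<in> elems (calderon_lozanovskii M X G)"
    using f by (auto simp: multipliers_def)
  assume "\<not> ?thesis"
  then have top: "(SUP g\<in>{g \<in> elems (calderon_lozanovskii M X F). fnorm (calderon_lozanovskii M X F) g = 1}.
      fnorm (calderon_lozanovskii M X G) (\<lambda>x. f x * g x)) = top"
    by (simp add: multipliers_def not_less top_unique)
  have "\<exists>g. g \<in> elems (calderon_lozanovskii M X F) \<and> fnorm (calderon_lozanovskii M X F) g = 1
      \<and> ennreal (4 ^ k) < fnorm (calderon_lozanovskii M X G) (\<lambda>x. f x * g x)" for k
  proof -
    have "ennreal (4 ^ k) < (SUP g\<in>{g \<in> elems (calderon_lozanovskii M X F). fnorm (calderon_lozanovskii M X F) g = 1}.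
      fnorm (calderon_lozanovskii M X G) (\<lambda>x. f x * g x))"
      unfolding top by simp
    then show ?thesis
      unfolding less_SUP_iff by auto
  qed
  then obtain g where g: "\<And>k. g k \<in> elems (calderon_lozanovskii M X F)"
    "\<And>k. fnorm (calderon_lozanovskii M X F) (g k) = 1"
    "\<And>k. ennreal (4 ^ k) < fnorm (calderon_lozanovskii M X G) (\<lambda>x. f x * g k x)"
    by metis
  have gm [measurable]: "g k \<in> borel_measurable M" for k
    using g(1) by (simp add: cl_elems_iff)
  have g2: "ext_norm M X (\<lambda>x. F (norm (g k x) / 2)) \<le> 1" for k
    using g(2)[of k] by (intro cl_norm_less young_mono[OF F]) auto
  obtain u where u: "u \<in> elems (calderon_lozanovskii M X F)"
    "\<And>k. AE x in M. norm (g k x) \<le> 2 ^ (k + 3) * norm (u x)"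
    using gliding_hump_majorant[where g = g, OF F gm g2] by metis
  obtain l where l: "0 < l" "ext_norm M X (\<lambda>x. G (norm (f x * u x) / l)) \<le> 1"
    using cl_normalize[OF G mult[OF u(1)]] .
  have "2 ^ k \<le> 8 * l" for k :: nat
  proof -
    have "ext_norm M X (\<lambda>x. G (norm (f x * g k x) / (2 ^ (k + 3) * l))) \<le> ext_norm M X (\<lambda>x. G (norm (f x * u x) / l))"
    proof (rule ext_norm_mono_AE)
      show "(\<lambda>x. G (norm (f x * g k x) / (2 ^ (k + 3) * l))) \<in> borel_measurable M"
        using l by (intro modular_measurable young_mono[OF G]) auto
      from u(2)[of k] show "AE x in M. G (norm (f x * g k x) / (2 ^ (k + 3) * l)) \<le> G (norm (f x * u x) / l)"
      proof eventually_elim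
        case (elim x)
        have "norm (f x) * norm (g k x) \<le> norm (f x) * (2 ^ (k + 3) * norm (u x))"
          using elim by (intro mult_left_mono) auto
        then show ?case
          using l by (intro young_monoD[OF G]) (auto simp: norm_mult divide_le_eq mult_ac)
      qed
    qed
    then have "fnorm (calderon_lozanovskii M X G) (\<lambda>x. f x * g k x) \<le> ennreal (2 ^ (k + 3) * l)"
      using l by (intro cl_norm_le) auto
    with g(3)[of k] have "ennreal (4 ^ k) < ennreal (2 ^ (k + 3) * l)"
      by (rule less_le_trans)
    then have "4 ^ k < 2 ^ (k + 3) * l"
      by (subst (asm) ennreal_less_iff) auto
    also have "(4::real) ^ k = 2 ^ k * 2 ^ k"
      by (simp flip: power_mult_distrib)
    also have "2 ^ (k + 3) * l = 2 ^ k * (8 * l)"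
      by (simp add: power_add)
    finally show ?thesis
      by simp
  qed
  moreover obtain k :: nat where "8 * l < 2 ^ k"
    using real_arch_pow[of 2 "8 * l"] by auto
  ultimately show False
    using not_less by blast
qed

section \<open>Factorization: from the multipliers into the conjugate space\<close>

text \<open>By \<open>multiplier_modular\<close>, this holds for every positive \<open>r\<close>
  above the multiplier norm of \<open>f\<close>. The modular form suits test functions that are
  controlled through their modular.\<close>

definition modular_multiplier :: "(real \<Rightarrow> ennreal) \<Rightarrow> (real \<Rightarrow> ennreal) \<Rightarrow> real \<Rightarrow> ('a \<Rightarrow> 'k) \<Rightarrow> bool" where
  "modular_multiplier F G r f \<longleftrightarrow> (\<forall>g\<in>borel_measurable M.
    ext_norm M X (\<lambda>x. F (norm (g x))) \<le> 1 \<longrightarrow> ext_norm M X (\<lambda>x. G (norm (f x * g x) / r)) \<le> 1)"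

text \<open>The test functions are \<open>d\<close> times the indicators of the blocks, with
  \<open>F d \<le> 1 / D\<close> so that their modular is at most 1. One \<open>d\<close> serves all
  blocks, so the countable cover gives a global bound that is independent of
  \<open>f\<close>.\<close>

lemma multiplier_sup_bound:
  assumes F: "young_function F" and G: "young_function G"
  obtains R where "0 < R" "\<And>f. f \<in> borel_measurable M \<Longrightarrow>
    modular_multiplier F G 1 f \<Longrightarrow> AE x in M. norm (f x) \<le> R"
proof -
  obtain d where d: "0 < d" "F d \<le> ennreal (1 / D)"
    using young_small[OF F, of "1 / D"] D_pos by auto
  obtain K where K: "1 \<le> K"
    "\<And>f l. 0 < l \<Longrightarrow> ext_norm M X (\<lambda>x. G (norm (f x :: 'k) / l)) \<le> ennreal 1 \<Longrightarrow> AE x in M. norm (f x) \<le> K * l"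
    using modular_bounded[OF G, of 1] by metis
  show ?thesis
  proof (rule that[of "K / d"])
    show "0 < K / d" using K d by simp
    fix f :: "'a \<Rightarrow> 'k" assume fm [measurable]: "f \<in> borel_measurable M"
      and mult: "modular_multiplier F G 1 f"
    have "AE x in M. x \<in> B n \<longrightarrow> norm (f x) \<le> K / d" for n
    proof -
      define g :: "'a \<Rightarrow> 'k" where "g x = indicator (B n) x * of_real d" for x
      note block_sets[of n, measurable]
      have gm [measurable]: "g \<in> borel_measurable M"
        unfolding g_def by measurable
      have "ext_norm M X (\<lambda>x. F (norm (g x))) \<le> ext_norm M X (\<lambda>x. ennreal (1 / D) * indicator (B n) x)"
        using modular_measurable[OF young_mono[OF F] gm, of 1] d
        by (intro ext_norm_mono) (auto simp: g_def indicator_def young_zero[OF F])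
      also have "\<dots> \<le> ennreal (1 / D) * ext_norm M X (indicator (B n))"
        using D_pos by (intro ext_norm_scale) simp
      also have "ext_norm M X (indicator (B n)) \<le> ennreal D"
        using ext_norm_block .
      also have "ennreal (1 / D) * ennreal D = 1"
        using D_pos by (simp flip: ennreal_mult')
      finally have "ext_norm M X (\<lambda>x. G (norm (f x * g x))) \<le> 1"
        using mult by (simp add: modular_multiplier_def mult_left_mono)
      then have "AE x in M. norm (f x * g x) \<le> K * 1"
        by (intro K(2)) auto
      then show ?thesis
        by eventually_elim (use d in \<open>auto simp: g_def norm_mult field_simps\<close>)
    qed
    then have "AE x in M. \<forall>n. x \<in> B n \<longrightarrow> norm (f x) \<le> K / d"
      unfolding AE_all_countable by blast
    then show "AE x in M. norm (f x) \<le> K / d"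
      using AE_space by eventually_elim (use block_cover in auto)
  qed
qed

text \<open>
  A greedy choice: \<open>s\<close> realises the largest of the first \<open>n\<close> candidates in the supremum
  defining the conjugate, or vanishes if none of them is positive.
\<close>

lemma conj_selection:
  fixes f :: "'a \<Rightarrow> 'k" and q :: "nat \<Rightarrow> real"
  assumes F: "young_function F" and G: "young_function G"
    and fm [measurable]: "f \<in> borel_measurable M" and q: "\<And>k. q k \<in> {0..1}"
  shows "\<exists>s\<in>borel_measurable M. \<forall>x. 0 \<le> s x \<and> s x \<le> 1 \<and>
    (SUP k\<in>{..<n}. G (q k * norm (f x)) - F (q k)) + F (s x) \<le> G (s x * norm (f x))"
proof (induction n)
  case 0
  then show ?case
    by (intro bexI[of _ "\<lambda>x. 0"]) (auto simp: young_zero[OF F] young_zero[OF G] bot_ennreal)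
next
  case (Suc n)
  let ?a = "\<lambda>k x. G (q k * norm (f x)) - F (q k)"
  let ?h = "\<lambda>n x. SUP k\<in>{..<n}. ?a k x"
  from Suc obtain s where sm [measurable]: "s \<in> borel_measurable M"
    and s: "\<And>x. 0 \<le> s x" "\<And>x. s x \<le> 1" "\<And>x. ?h n x + F (s x) \<le> G (s x * norm (f x))"
    by blast
  have [measurable]: "(\<lambda>x. G (q k * norm (f x))) \<in> borel_measurable M" for k
    using q[of k] by (intro borel_measurable_mono_on_nonneg young_mono[OF G]) auto
  have [measurable]: "Measurable.pred M (\<lambda>x. ?h n x < ?a n x)"
    by measurable
  let ?s = "\<lambda>x. if ?h n x < ?a n x then q n else s x"
  have "?h (Suc n) x + F (?s x) \<le> G (?s x * norm (f x))" for x
  proof (cases "?h n x < ?a n x")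
    case True
    \<comment> \<open>The new difference exceeds a nonnegative supremum and is therefore positive.
      Hence the subtraction did not truncate, and adding \<open>F (q n)\<close> back is
      exact.\<close>
    have "F (q n) \<le> G (q n * norm (f x))"
    proof (rule ccontr)
      assume "\<not> F (q n) \<le> G (q n * norm (f x))"
      then have "?a n x = 0"
        by (simp add: diff_eq_0_iff_ennreal not_le less_imp_le less_le_trans[OF _ top_greatest])
      then show False
        using True by simp
    qed
    moreover have "?h (Suc n) x = ?a n x"
      using True by (simp add: lessThan_Suc sup_max max_absorb1)
    ultimately show ?thesis
      using True by (simp add: diff_add_cancel_ennreal)
  next
    case False
    then have "?h (Suc n) x = ?h n x"
      by (simp add: lessThan_Suc sup_max max_absorb2 not_less)
    then show ?thesis
      using s(3)[of x] False by simp
  qed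
  moreover have "?s \<in> borel_measurable M"
    by measurable
  ultimately show ?case
    using q[of n] s by (intro bexI[of _ ?s]) auto
qed

text \<open>A rational \<open>r\<close> with \<open>s / 2 \<le> r \<le> s\<close> satisfies
  \<open>s * (t / 2) \<le> r * t\<close> and \<open>F r \<le> F s\<close>, so monotonicity compares
  the terms. The factor 2 pays for a countable supremum, as the measurable selection and the Fatou
  property require.\<close>

lemma conj_rational_approx:
  fixes q :: "nat \<Rightarrow> real"
  assumes F: "young_function F" and G: "young_function G"
    and q: "range q = {0..1} \<inter> \<rat>" and t: "0 \<le> t"
  shows "young_conj G 1 F (t / 2) \<le> (SUP k. G (q k * t) - F (q k))"
  unfolding young_conj_def
proof (rule SUP_least)
  fix s :: real assume s: "s \<in> {0..1}"
  obtain r where r: "r \<in> \<rat>" "s / 2 \<le> r" "r \<le> s"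
  proof (cases "s = 0")
    case True
    then show ?thesis using that[of 0] by simp
  next
    case False
    then show ?thesis
      using Rats_dense_in_real[of "s / 2" s] s that by fastforce
  qed
  then have "r \<in> range q"
    using s by (simp add: q)
  then obtain k where k: "q k = r" by auto
  have "s / 2 * t \<le> r * t"
    using r t by (intro mult_right_mono)
  then have "G (s * (t / 2)) - F s \<le> G (q k * t) - F (q k)"
    using r s t k by (intro ennreal_minus_mono young_monoD[OF G] young_monoD[OF F]) auto
  also have "\<dots> \<le> (SUP k. G (q k * t) - F (q k))"
    by (rule SUP_upper) simp
  finally show "G (s * (t / 2)) - F s \<le> (SUP k. G (q k * t) - F (q k))" .
qed

text \<open>
  Since \<open>F s \<le> G (s |f|)\<close> is small, adding one block to the support of \<open>s\<close> raises the
  modular of \<open>s\<close> from at most \<open>1/2\<close> to at most \<open>1\<close>; the multiplier hypothesis then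
  brings it back to at most \<open>1/2\<close>.
\<close>

lemma selection_modular:
  fixes f :: "'a \<Rightarrow> 'k"
  assumes F: "young_function F" and G: "young_function G"
    and fm [measurable]: "f \<in> borel_measurable M" and sm [measurable]: "s \<in> borel_measurable M"
    and s: "\<And>x. 0 \<le> s x" and le: "\<And>x. h x + F (s x) \<le> G (s x * norm (f x))"
    and hm [measurable]: "h \<in> borel_measurable M"
    and small: "AE x in M. G (s x * norm (f x)) \<le> ennreal (1 / (2 * D))"
    and mult: "\<And>g. g \<in> borel_measurable M \<Longrightarrow> ext_norm M X (\<lambda>x. F (norm (g x))) \<le> 1 \<Longrightarrow>
      ext_norm M X (\<lambda>x. G (norm (f x * g x :: 'k))) \<le> ennreal (1 / 2)"
  shows "ext_norm M X (\<lambda>x. h x * indicator (\<Union>k<m. B k) x) \<le> ennreal (1 / 2)"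
proof -
  note block_sets[measurable]
  define S where "S m = (\<Union>k<m::nat. B k)" for m
  have [measurable]: "S m \<in> sets M" for m
    unfolding S_def by measurable
  have Fs [measurable]: "(\<lambda>x. F (s x)) \<in> borel_measurable M"
    using s by (intro borel_measurable_mono_on_nonneg young_mono[OF F]) auto
  define g :: "nat \<Rightarrow> 'a \<Rightarrow> 'k" where "g m x = of_real (s x * indicator (S m) x)" for m x
  have gm [measurable]: "g m \<in> borel_measurable M" for m
    unfolding g_def by measurable
  have Fg: "F (norm (g m x)) = F (s x) * indicator (S m) x" for m x
    using s[of x] by (simp add: g_def indicator_def young_zero[OF F])
  have Gg: "G (norm (f x * g m x)) = G (s x * norm (f x)) * indicator (S m) x" for m x
    using s[of x] by (simp add: g_def indicator_def young_zero[OF G] norm_mult mult.commute)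
  have step: "ext_norm M X (\<lambda>x. h x * indicator (S m) x) \<le> ennreal (1 / 2) \<and>
      ext_norm M X (\<lambda>x. F (s x) * indicator (S m) x) \<le> ennreal (1 / 2)"
    if "ext_norm M X (\<lambda>x. F (s x) * indicator (S m) x) \<le> 1" for m
  proof -
    have G1: "ext_norm M X (\<lambda>x. G (s x * norm (f x)) * indicator (S m) x) \<le> ennreal (1 / 2)"
      using mult[OF gm, of m] that by (simp add: Fg Gg)
    have "h x \<le> G (s x * norm (f x))" "F (s x) \<le> G (s x * norm (f x))" for x
      using le[of x] by (auto intro: order_trans[rotated])
    then have "ext_norm M X (\<lambda>x. h x * indicator (S m) x) \<le> ext_norm M X (\<lambda>x. G (s x * norm (f x)) * indicator (S m) x)"
      "ext_norm M X (\<lambda>x. F (s x) * indicator (S m) x) \<le> ext_norm M X (\<lambda>x. G (s x * norm (f x)) * indicator (S m) x)"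
      by (auto intro!: ext_norm_mono mult_right_mono)
    then show ?thesis
      using G1 by (auto intro: order_trans)
  qed
  have "ext_norm M X (\<lambda>x. F (s x) * indicator (S m) x) \<le> ennreal (1 / 2)"
  proof (induction m)
    case 0
    then show ?case by (simp add: S_def ext_norm_zero)
  next
    case (Suc m)
    \<comment> \<open>The bound \<open>1 / (2 * D)\<close> is tailored to the block norm: the new
      block contributes at most \<open>D / (2 * D) = 1 / 2\<close>.\<close>
    have "ext_norm M X (\<lambda>x. F (s x) * indicator (S (Suc m)) x)
      \<le> ext_norm M X (\<lambda>x. F (s x) * indicator (S m) x + ennreal (1 / (2 * D)) * indicator (B m) x)"
    proof (rule ext_norm_mono_AE)
      from small show "AE x in M. F (s x) * indicator (S (Suc m)) x
          \<le> F (s x) * indicator (S m) x + ennreal (1 / (2 * D)) * indicator (B m) x"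
      proof eventually_elim
        case (elim x)
        then have "F (s x) \<le> ennreal (1 / (2 * D))"
          using le[of x] by (auto intro: order_trans[rotated])
        then show ?case
          by (auto simp: S_def lessThan_Suc indicator_def)
      qed
    qed measurable
    also have "\<dots> \<le> ext_norm M X (\<lambda>x. F (s x) * indicator (S m) x)
        + ext_norm M X (\<lambda>x. ennreal (1 / (2 * D)) * indicator (B m) x)"
      by (rule ext_norm_add) measurable
    also have "\<dots> \<le> ennreal (1 / 2) + ennreal (1 / (2 * D)) * ennreal D"
      using D_pos
      by (intro add_mono Suc order_trans[OF ext_norm_scale] mult_left_mono ext_norm_block) auto
    also have "\<dots> = ennreal (1 / 2 + 1 / 2)"
      using D_pos by (simp flip: ennreal_mult' ennreal_plus del: ennreal_half)
    finally have "ext_norm M X (\<lambda>x. F (s x) * indicator (S (Suc m)) x) \<le> 1"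
      by simp
    then show ?case
      using step by blast
  qed
  then have "ext_norm M X (\<lambda>x. F (s x) * indicator (S m) x) \<le> 1"
    by (rule order_trans) (simp del: ennreal_half)
  from step[OF this] show ?thesis
    by (simp add: S_def)
qed

text \<open>One index \<open>n\<close> counts both the candidates in the supremum and the blocks in
  the support. Each stage is handled by \<open>selection_modular\<close>, and a single passage to
  the limit reaches the conjugate on the whole space.\<close>

lemma small_multiplier_conj_modular:
  fixes f :: "'a \<Rightarrow> 'k"
  assumes F: "young_function F" and G: "young_function G"
    and fm [measurable]: "f \<in> borel_measurable M"
    and d: "G d \<le> ennreal (1 / (2 * D))" and fd: "AE x in M. norm (f x) \<le> d"
    and mult: "\<And>g. g \<in> borel_measurable M \<Longrightarrow> ext_norm M X (\<lambda>x. F (norm (g x))) \<le> 1 \<Longrightarrow>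
      ext_norm M X (\<lambda>x. G (norm (f x * g x :: 'k))) \<le> ennreal (1 / 2)"
  shows "ext_norm M X (\<lambda>x. young_conj G 1 F (norm (f x) / 2)) \<le> 1"
proof -
  note block_sets[measurable]
  have "(0 :: real) \<in> {0..1} \<inter> \<rat>"
    by simp
  then have "{0..1} \<inter> \<rat> \<noteq> ({} :: real set)" "countable ({0..1} \<inter> \<rat> :: real set)"
    by (blast, simp add: countable_rat)
  then obtain q :: "nat \<Rightarrow> real" where q: "range q = {0..1} \<inter> \<rat>"
    using uncountable_def by metis
  then have q01: "q k \<in> {0..1}" for k
    by blast
  define a where "a k x = G (q k * norm (f x)) - F (q k)" for k x
  have [measurable]: "(\<lambda>x. G (q k * norm (f x))) \<in> borel_measurable M" for k
    using q01[of k] by (intro borel_measurable_mono_on_nonneg young_mono[OF G]) auto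
  have am [measurable]: "a k \<in> borel_measurable M" for k
    unfolding a_def by measurable
  define h where "h n x = (SUP k\<in>{..<n}. a k x)" for n :: nat and x
  have hm [measurable]: "h n \<in> borel_measurable M" for n
    unfolding h_def by measurable
  define S where "S n = (\<Union>k<n::nat. B k)" for n
  have [measurable]: "S n \<in> sets M" for n
    unfolding S_def by measurable
  have small: "AE x in M. G (t x * norm (f x)) \<le> ennreal (1 / (2 * D))"
    if "\<And>x. 0 \<le> t x" "\<And>x. t x \<le> 1" for t
    using fd
  proof eventually_elim
    case (elim x)
    then have "t x * norm (f x) \<le> 1 * d"
      using that by (intro mult_mono) auto
    then show ?case
      using that by (intro order_trans[OF young_monoD[OF G] d]) auto
  qed
  have hS: "ext_norm M X (\<lambda>x. h n x * indicator (S n) x) \<le> ennreal (1 / 2)" for n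
  proof -
    obtain s where s: "s \<in> borel_measurable M" "\<And>x. 0 \<le> s x" "\<And>x. s x \<le> 1"
      "\<And>x. h n x + F (s x) \<le> G (s x * norm (f x))"
      using conj_selection[where q = q and n = n, OF F G fm q01] unfolding h_def a_def by blast
    show ?thesis
      unfolding S_def using selection_modular[OF F G fm s(1,2,4) hm small[OF s(2,3)] mult] .
  qed
  have "AE x in M. \<forall>k. a k x \<le> ennreal (1 / (2 * D))"
    unfolding AE_all_countable
  proof
    fix k
    have "AE x in M. G (q k * norm (f x)) \<le> ennreal (1 / (2 * D))"
      using q01[of k] by (intro small) auto
    then show "AE x in M. a k x \<le> ennreal (1 / (2 * D))"
      unfolding a_def by eventually_elim (meson diff_le_self_ennreal order_trans)
  qed
  then have "AE x in M. (SUP n. h n x * indicator (S n) x) < \<infinity>"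
  proof eventually_elim
    case (elim x)
    have "h n x * indicator (S n) x \<le> ennreal (1 / (2 * D))" for n
    proof -
      have "h n x \<le> ennreal (1 / (2 * D))"
        unfolding h_def using elim by (intro SUP_least) auto
      then show ?thesis by (simp add: indicator_def)
    qed
    then have "(SUP n. h n x * indicator (S n) x) \<le> ennreal (1 / (2 * D))"
      by (intro SUP_least)
    then show ?case
      by (simp add: le_less_trans)
  qed
  moreover have h_mono: "h n x \<le> h m x" "S n \<subseteq> S m" if "n \<le> m" for n m x
    using that unfolding h_def S_def by (auto intro!: SUP_subset_mono) (meson lessThan_iff less_le_trans)
  moreover have "h n x * indicator (S n) x \<le> h (Suc n) x * indicator (S (Suc n)) x" for n x
    using h_mono[of n "Suc n"] by (intro mult_mono) (auto simp: indicator_def)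
  ultimately have "ext_norm M X (\<lambda>x. SUP n. h n x * indicator (S n) x) \<le> ennreal (1 / 2)"
    using hS by (intro ext_norm_SUP) (auto simp del: ennreal_half)
  moreover have "ext_norm M X (\<lambda>x. young_conj G 1 F (norm (f x) / 2))
    \<le> ext_norm M X (\<lambda>x. SUP n. h n x * indicator (S n) x)"
  proof (rule ext_norm_mono)
    show "(\<lambda>x. young_conj G 1 F (norm (f x) / 2)) \<in> borel_measurable M"
      by (intro modular_measurable mono_young_conj G) auto
    fix x assume "x \<in> space M"
    then obtain i where i: "x \<in> B i"
      using block_cover by auto
    have "young_conj G 1 F (norm (f x) / 2) \<le> (SUP k. a k x)"
      unfolding a_def by (intro conj_rational_approx F G q) simp
    also have "\<dots> \<le> (SUP n. h n x * indicator (S n) x)"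
    proof (rule SUP_least)
      fix k
      \<comment> \<open>At this stage both the candidate \<open>k\<close> and the block
        \<open>B i\<close> containing \<open>x\<close> are present.\<close>
      let ?n = "Suc (max i k)"
      have "a k x \<le> h ?n x * indicator (S ?n) x"
        using i unfolding h_def S_def by (auto simp: indicator_def less_Suc_eq_le intro!: SUP_upper)
      then show "a k x \<le> (SUP n. h n x * indicator (S n) x)"
        by (rule SUP_upper2[rotated]) simp
    qed
    finally show "young_conj G 1 F (norm (f x) / 2) \<le> (SUP n. h n x * indicator (S n) x)" .
  qed
  ultimately have "ext_norm M X (\<lambda>x. young_conj G 1 F (norm (f x) / 2)) \<le> ennreal (1 / 2)"
    by (rule order_trans[rotated])
  then show ?thesis
    by (rule order_trans) (simp del: ennreal_half)
qed

lemma multiplier_conj_modular: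
  assumes F: "young_function F" and G: "young_function G"
  obtains c where "0 < c" "\<And>f r. f \<in> borel_measurable M \<Longrightarrow> 0 < r \<Longrightarrow>
    modular_multiplier F G r f \<Longrightarrow>
    ext_norm M X (\<lambda>x. young_conj G 1 F (norm (f x) / (c * r))) \<le> 1"
proof -
  obtain R where R: "0 < R" "\<And>f. f \<in> borel_measurable M \<Longrightarrow>
    modular_multiplier F G 1 f \<Longrightarrow> AE x in M. norm (f x) \<le> R"
    using multiplier_sup_bound[OF F G] by metis
  obtain d where d: "0 < d" "G d \<le> ennreal (1 / (2 * D))"
    using young_small[OF G, of "1 / (2 * D)"] D_pos by auto
  \<comment> \<open>\<open>u \<ge> R / d\<close> pushes the rescaled multiplier below
    \<open>d\<close>, where \<open>G\<close> is small, and \<open>u \<ge> 2\<close> brings the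
    modulars of products to 1/2. The further factor 2 in \<open>2 * u\<close> comes from the
    rational approximation.\<close>
  define u where "u = max 2 (R / d)"
  have u: "2 \<le> u" "R / u \<le> d"
    using R d by (auto simp: u_def field_simps max_def)
  show ?thesis
  proof (rule that[of "2 * u"])
    show "0 < 2 * u" using u by simp
    fix f :: "'a \<Rightarrow> 'k" and r :: real
    assume fm [measurable]: "f \<in> borel_measurable M" and r: "0 < r"
      and mult: "modular_multiplier F G r f"
    have "AE x in M. norm (of_real (1 / r) * f x) \<le> R"
      using mult r by (intro R(2)) (auto simp: modular_multiplier_def norm_mult norm_divide)
    then have bd: "AE x in M. norm (of_real (1 / (u * r)) * f x) \<le> d"
    proof eventually_elim
      case (elim x)
      then have "norm (f x) / r / u \<le> R / u"
        using r u by (intro divide_right_mono) (auto simp: norm_mult norm_divide)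
      then show ?case
        using u r by (simp add: norm_mult norm_divide mult.commute)
    qed
    have "ext_norm M X (\<lambda>x. young_conj G 1 F (norm (of_real (1 / (u * r)) * f x) / 2)) \<le> 1"
    proof (rule small_multiplier_conj_modular[OF F G _ d(2) bd])
      fix g :: "'a \<Rightarrow> 'k" assume g: "g \<in> borel_measurable M" "ext_norm M X (\<lambda>x. F (norm (g x))) \<le> 1"
      have "ext_norm M X (\<lambda>x. G (norm (f x * g x) / (u * r)))
        \<le> ennreal (1 / u) * ext_norm M X (\<lambda>x. G (norm (f x * g x) / r))"
        using g u r by (intro modular_scale[OF G]) auto
      also have "\<dots> \<le> ennreal (1 / 2) * 1"
        using u g mult by (intro mult_mono ennreal_leI) (auto simp: modular_multiplier_def field_simps)
      finally show "ext_norm M X (\<lambda>x. G (norm (of_real (1 / (u * r)) * f x * g x))) \<le> ennreal (1 / 2)"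
        using u r by (simp add: norm_mult norm_divide mult.assoc)
    qed measurable
    then show "ext_norm M X (\<lambda>x. young_conj G 1 F (norm (f x) / (2 * u * r))) \<le> 1"
      using u r by (simp add: norm_mult norm_divide mult_ac)
  qed
qed

theorem multipliers_eq_cl_conj:
  assumes F: "young_function F" and G: "young_function G"
  shows "equal_with_equivalent_norms
    (multipliers M (calderon_lozanovskii M X F) (calderon_lozanovskii M X G))
    (calderon_lozanovskii M X (young_conj G 1 F))"
proof -
  let ?P = "multipliers M (calderon_lozanovskii M X F) (calderon_lozanovskii M X G)"
  let ?H = "calderon_lozanovskii M X (young_conj G 1 F)"
  obtain c where c: "0 < c" "\<And>f. f \<in> borel_measurable M \<Longrightarrow> ennreal c * fnorm ?P f \<le> fnorm ?H f"
    using multiplier_norm_le_cl_conj[OF F G] by metis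
  obtain b where b: "0 < b" "\<And>f r. f \<in> borel_measurable M \<Longrightarrow> 0 < r \<Longrightarrow>
    modular_multiplier F G r f \<Longrightarrow>
    ext_norm M X (\<lambda>x. young_conj G 1 F (norm (f x) / (b * r))) \<le> 1"
    using multiplier_conj_modular[OF F G] by blast
  have meas: "f \<in> borel_measurable M" if "f \<in> elems ?P" for f
    using that by (simp add: multipliers_def)
  have H1: "ext_norm M X (\<lambda>x. young_conj G 1 F (norm (f x) / (b * r))) \<le> 1"
    if f: "f \<in> elems ?P" "0 < r" "fnorm ?P f < ennreal r" for f r
    using that meas[OF f(1)] by (auto simp: modular_multiplier_def intro!: b(2) multiplier_modular[OF F G])
  have le: "fnorm ?H f \<le> ennreal b * fnorm ?P f" if f: "f \<in> elems ?P" for f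
  proof -
    obtain p where p: "0 \<le> p" "fnorm ?P f = ennreal p"
      using multiplier_norm_finite[OF F G f] by (cases "fnorm ?P f") auto
    have "fnorm ?H f \<le> ennreal (b * p)"
    proof (rule ennreal_le_epsilon)
      fix e :: real assume e: "0 < e"
      \<comment> \<open>\<open>H1\<close> needs a scale strictly above the multiplier norm
        \<open>p\<close>; the excess \<open>e / b\<close> becomes exactly \<open>e\<close> after
        multiplication by \<open>b\<close>.\<close>
      have "fnorm ?H f \<le> ennreal (b * (p + e / b))"
        using f e p b(1) by (intro cl_norm_le H1) (auto simp: ennreal_less_iff intro!: add_nonneg_pos mult_pos_pos)
      also have "b * (p + e / b) = b * p + e"
        using b(1) by (simp add: field_simps)
      finally show "fnorm ?H f \<le> ennreal (b * p) + ennreal e"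
        using p e b(1) by simp
    qed
    then show ?thesis
      using b(1) p by (simp add: ennreal_mult)
  qed
  have "elems ?P \<subseteq> elems ?H"
  proof
    fix f assume f: "f \<in> elems ?P"
    obtain p where p: "0 \<le> p" "fnorm ?P f = ennreal p"
      using multiplier_norm_finite[OF F G f] by (cases "fnorm ?P f") auto
    have "ext_norm M X (\<lambda>x. young_conj G 1 F (norm (f x) / (b * (p + 1)))) \<le> 1"
      using f p by (intro H1) (auto simp: ennreal_less_iff)
    then have "ext_norm M X (\<lambda>x. young_conj G 1 F (norm (f x) / (b * (p + 1)))) < \<infinity>"
      by (rule le_less_trans) simp
    moreover have "0 < b * (p + 1)"
      using b(1) p by simp
    ultimately show "f \<in> elems ?H"
      using meas[OF f] by (auto simp: cl_elems_iff)
  qed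
  with cl_conj_subset_multipliers[OF F G] have "elems ?P = elems ?H"
    by blast
  then show ?thesis
    unfolding equal_with_equivalent_norms_def using b(1) c le meas by blast
qed

end

section \<open>Indicators, and the block property on the three underlying spaces\<close>

lemma equimeasurable_indicator:
  assumes "A \<subseteq> space M" "E \<subseteq> space M" "emeasure M A = emeasure M E"
  shows "equimeasurable M (indicator A :: 'a \<Rightarrow> 'k :: real_normed_algebra_1) (indicator E)"
  unfolding equimeasurable_def
proof (intro allI impI)
  fix l :: real assume "0 \<le> l"
  then have "{x \<in> space M. norm (indicator T x :: 'k) > l} = (if l < 1 then T else {})" if "T \<subseteq> space M" for T
    using that by (auto simp: indicator_def split: if_splits)
  then show "emeasure M {x \<in> space M. norm (indicator A x :: 'k) > l} = emeasure M {x \<in> space M. norm (indicator E x :: 'k) > l}"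
    using assms by simp
qed

lemma rearrangement_indicator:
  assumes X: "rearrangement_invariant_space M (X :: ('a, 'k :: {real_normed_field, euclidean_space}) fun_space)"
    and A: "indicator A \<in> elems X" "A \<in> sets M" and E: "E \<in> sets M" "emeasure M A = emeasure M E"
  shows "indicator E \<in> elems X" "fnorm X (indicator E) = fnorm X (indicator A)"
proof -
  have "equimeasurable M (indicator A :: 'a \<Rightarrow> 'k) (indicator E)"
    using A E by (intro equimeasurable_indicator sets.sets_into_space) auto
  then show "indicator E \<in> elems X" "fnorm X (indicator E) = fnorm X (indicator A)"
    using rearrangement_invariant_space.rearrangement_mem[OF X A(1)]
      rearrangement_invariant_space.rearrangement_norm[OF X A(1)] E(1) by auto
qed

lemma (in banach_ideal_space) indicator_subset:
  assumes "indicator A \<in> elems X" "E \<in> sets M" "E \<subseteq> A"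
  shows "indicator E \<in> elems X" "fnorm X (indicator E) \<le> fnorm X (indicator A)"
proof -
  have "AE x in M. norm (indicator E x :: 'k) \<le> norm (indicator A x :: 'k)"
    using assms(3) by (auto simp: indicator_def)
  then show "indicator E \<in> elems X" "fnorm X (indicator E) \<le> fnorm X (indicator A)"
    using ideal_mem[OF _ assms(1)] ideal_norm[OF _ assms(1)] assms(2) by auto
qed

text \<open>Chebyshev's inequality in \<open>X\<close>: the function \<open>r\<close> times the
  indicator is dominated by \<open>f\<close>, so the ideal property applies.\<close>

lemma (in banach_ideal_space) indicator_level_norm:
  assumes f: "f \<in> elems X" and E: "E \<in> sets M" and r: "0 < r" "\<And>x. x \<in> E \<Longrightarrow> r \<le> norm (f x)"
  shows "indicator E \<in> elems X" "ennreal r * fnorm X (indicator E) \<le> fnorm X f"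
proof -
  have m: "(\<lambda>x. of_real r * indicator E x :: 'k) \<in> borel_measurable M"
    using E by measurable
  have ae: "AE x in M. norm (of_real r * indicator E x :: 'k) \<le> norm (f x)"
    using r by (auto simp: indicator_def)
  have rE: "(\<lambda>x. of_real r * indicator E x :: 'k) \<in> elems X"
    using ideal_mem[OF m f ae] .
  have "(\<lambda>x. of_real (1 / r) * (of_real r * indicator E x :: 'k)) = indicator E"
    using r by (simp add: mult.assoc[symmetric] flip: of_real_mult)
  then show iE: "indicator E \<in> elems X"
    using scale_mem[OF rE, of "of_real (1 / r)"] by simp
  show "ennreal r * fnorm X (indicator E) \<le> fnorm X f"
    using norm_scale[OF iE, of "of_real r"] ideal_norm[OF m f ae] r by simp
qed

text \<open>The blocks are singletons. They all have the same measure, so their indicators share one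
  norm \<open>D > 0\<close>; Chebyshev's inequality on a singleton then gives the embedding constant
  \<open>1 / D\<close>.\<close>

lemma block_bounded_space_count:
  assumes X: "rearrangement_invariant_space (count_space UNIV) (X :: (nat, 'k :: {real_normed_field, euclidean_space}) fun_space)"
  shows "\<exists>C D. block_bounded_space (count_space UNIV) X C D (\<lambda>n. {n})"
proof -
  interpret rearrangement_invariant_space "count_space UNIV" X by (rule X)
  obtain f k where f: "f \<in> elems X" and k: "f k \<noteq> 0"
    using nontrivial by (auto simp: AE_count_space)
  have k_mem: "indicator {k} \<in> elems X"
    using k by (intro indicator_level_norm[OF f, of _ "norm (f k)"]) auto
  have mem: "indicator {n} \<in> elems X" and eq: "fnorm X (indicator {n}) = fnorm X (indicator {k})" for n
    using rearrangement_indicator[OF X k_mem, of "{n}"] by auto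
  have "\<not> (AE x in count_space UNIV. indicator {k} x = (0 :: 'k))"
    by (auto simp: AE_count_space intro!: exI[of _ k])
  then have "fnorm X (indicator {k}) \<noteq> 0"
    using norm_eq_0_iff[OF k_mem] by simp
  moreover have "fnorm X (indicator {k}) < top"
    using norm_finite[OF k_mem] by simp
  moreover define D where "D = enn2real (fnorm X (indicator {k}))"
  ultimately have D: "0 < D" "fnorm X (indicator {k}) = ennreal D"
    by (simp_all add: enn2real_positive_iff zero_less_iff_neq_zero)
  have "ennreal (norm (g n)) \<le> ennreal (1 / D) * fnorm X g" if g: "g \<in> elems X" for g n
  proof (cases "g n = 0")
    case False
    then have "ennreal (norm (g n)) * ennreal D \<le> fnorm X g"
      using indicator_level_norm(2)[OF g, of "{n}" "norm (g n)"] eq[of n] by (simp add: D)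
    then have "ennreal (1 / D) * (ennreal (norm (g n)) * ennreal D) \<le> ennreal (1 / D) * fnorm X g"
      by (rule mult_left_mono) simp
    then show ?thesis
      using D by (simp add: ennreal_mult'[symmetric])
  qed simp
  then have "block_bounded_space (count_space UNIV) X (1 / D) D (\<lambda>n. {n})"
    using D mem eq by unfold_locales (auto simp: AE_count_space)
  then show ?thesis by blast
qed

text \<open>The set where \<open>f\<close> exceeds \<open>r\<close> is exhausted by the sets
  \<open>E n\<close>, one of which is not null. The gap \<open>1 / (n + 1)\<close> gives a uniform
  excess, and the cut at \<open>n\<close> gives finite measure because \<open>I\<close> lies in the
  half-line.\<close>

lemma nonnull_bounded_subset:
  assumes I: "I \<in> sets lebesgue" "I \<subseteq> {0..}"
    and f [measurable]: "(f :: real \<Rightarrow> real) \<in> borel_measurable (lebesgue_on I)"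
    and pos: "\<not> (AE x in lebesgue_on I. f x \<le> r)"
  obtains E e m where "E \<in> sets (lebesgue_on I)" "0 < e" "\<And>x. x \<in> E \<Longrightarrow> r + e \<le> f x"
    "0 < m" "emeasure (lebesgue_on I) E = ennreal m"
proof -
  have [simp]: "space (lebesgue_on I) = I"
    by simp
  define E where "E n = {x \<in> I. r + 1 / real (Suc n) \<le> f x \<and> x \<le> real n}" for n
  have idm: "(\<lambda>x. x) \<in> borel_measurable (lebesgue_on I)"
    by (rule measurable_restrict_space1) (simp add: measurable_completion)
  have Em: "E n \<in> sets (lebesgue_on I)" for n
  proof -
    have "{x \<in> space (lebesgue_on I). r + 1 / real (Suc n) \<le> f x \<and> x \<le> real n} \<in> sets (lebesgue_on I)"
      using idm by measurable
    then show ?thesis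
      by (simp add: E_def)
  qed
  obtain n where n: "emeasure (lebesgue_on I) (E n) \<noteq> 0"
  proof (rule ccontr)
    assume "\<not> thesis"
    then have "E n \<in> null_sets (lebesgue_on I)" for n
      using that Em by (auto simp: null_sets_def)
    then have "(\<Union>n. E n) \<in> null_sets (lebesgue_on I)"
      by (rule null_sets_UN)
    moreover have "{x \<in> space (lebesgue_on I). \<not> f x \<le> r} \<subseteq> (\<Union>n. E n)"
    proof
      fix x assume "x \<in> {x \<in> space (lebesgue_on I). \<not> f x \<le> r}"
      then have x: "x \<in> I" "r < f x"
        by auto
      obtain n1 :: nat where n1: "inverse (real (Suc n1)) < f x - r"
        using reals_Archimedean[of "f x - r"] x by auto
      obtain n2 :: nat where n2: "x \<le> real n2"
        using real_arch_simple by blast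
      have "1 / real (Suc (max n1 n2)) \<le> inverse (real (Suc n1))"
        by (simp add: inverse_eq_divide frac_le)
      then have "x \<in> E (max n1 n2)"
        using x n1 n2 by (auto simp: E_def)
      then show "x \<in> (\<Union>n. E n)"
        by blast
    qed
    ultimately have "AE x in lebesgue_on I. f x \<le> r"
      by (rule AE_I')
    then show False
      using pos by simp
  qed
  have "emeasure (lebesgue_on I) (E n) = emeasure lebesgue (E n)"
    using I by (intro emeasure_restrict_space) (auto simp: E_def)
  also have "\<dots> \<le> emeasure lebesgue {0..real n}"
    using I by (intro emeasure_mono) (auto simp: E_def)
  also have "\<dots> = ennreal (real n)"
    by (simp add: emeasure_lborel_Icc)
  finally obtain m where m: "0 \<le> m" "emeasure (lebesgue_on I) (E n) = ennreal m"
    by (cases "emeasure (lebesgue_on I) (E n)") (auto simp: top_unique)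
  then have "m \<noteq> 0"
    using n by auto
  then show ?thesis
  proof (intro that)
    show "r + 1 / real (Suc n) \<le> f x" if "x \<in> E n" for x
      using that by (simp add: E_def)
  qed (use m Em in auto)
qed

text \<open>If \<open>L > 0\<close> is the limit of the fundamental function at zero, an indicator
  in \<open>X\<close> of a set of positive finite measure has norm at least \<open>L\<close>.
  Applied to level sets, this bounds \<open>f\<close> almost everywhere by its norm divided by
  \<open>L\<close>.\<close>

lemma block_bounded_space_lebesgue:
  assumes X: "rearrangement_invariant_space (lebesgue_on I) (X :: (real, 'k :: {real_normed_field, euclidean_space}) fun_space)"
    and I: "I \<in> {{0..1}, {0..}}" and nonv: "nonvanishing_at_zero X"
  shows "\<exists>C D B. block_bounded_space (lebesgue_on I) X C D B"
proof -
  interpret rearrangement_invariant_space "lebesgue_on I" X by (rule X)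
  have Is: "I \<in> sets lebesgue" "I \<subseteq> {0..}"
    using I by auto
  have em: "emeasure (lebesgue_on I) E = emeasure lebesgue E" if "E \<subseteq> I" for E
    using Is that by (intro emeasure_restrict_space) auto
  have sets_on: "E \<in> sets (lebesgue_on I)" if "E \<in> sets lebesgue" "E \<subseteq> I" for E
    using that Is by (simp add: sets_restrict_space_iff)
  \<comment> \<open>The initial interval of the same measure replaces \<open>E\<close> by
    rearrangement invariance; it fits into \<open>I\<close> because \<open>E\<close> does.\<close>
  have initial: "{0..<m} \<subseteq> I" "{0..<m} \<in> sets (lebesgue_on I)" "emeasure (lebesgue_on I) {0..<m} = emeasure (lebesgue_on I) E"
    if E: "E \<in> sets (lebesgue_on I)" "emeasure (lebesgue_on I) E = ennreal m" "0 \<le> m" for E m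
  proof -
    have "E \<subseteq> I" "E \<in> sets lebesgue"
      using E(1) Is by (auto simp: sets_restrict_space_iff)
    show sub: "{0..<m} \<subseteq> I"
    proof (cases "I = {0..}")
      case False
      then have "I = {0..1}" using I by simp
      have "ennreal m \<le> emeasure lebesgue I"
        using em[OF \<open>E \<subseteq> I\<close>] E(2) \<open>E \<subseteq> I\<close> Is by (metis emeasure_mono)
      then show ?thesis
        using \<open>I = {0..1}\<close> by (auto simp: emeasure_lborel_Icc)
    qed auto
    then show "{0..<m} \<in> sets (lebesgue_on I)"
      by (intro sets_on) auto
    show "emeasure (lebesgue_on I) {0..<m} = emeasure (lebesgue_on I) E"
      using em[OF sub] E by (simp add: emeasure_lborel_Ico)
  qed
  obtain L where L: "0 < L" "(fundamental_function X \<longlongrightarrow> L) (at_right 0)"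
    using nonv by (auto simp: nonvanishing_at_zero_def)
  have L_le: "L \<le> fnorm X (indicator {0..<t})"
    if t: "0 < t" "indicator {0..<t} \<in> elems X" "{0..<t} \<subseteq> I" for t
  proof (rule tendsto_upperbound[OF L(2)])
    show "\<forall>\<^sub>F s in at_right 0. fundamental_function X s \<le> fnorm X (indicator {0..<t})"
      using eventually_at_right_less eventually_at_right_real[OF t(1)]
    proof eventually_elim
      case (elim s)
      then have "{0..<s} \<subseteq> {0..<t}" by auto
      then show ?case
        unfolding fundamental_function_def using t by (intro indicator_subset(2) sets_on) auto
    qed
  qed simp
  \<comment> \<open>The excess \<open>e\<close> makes the lower bound strict; this yields the
    contradiction at \<open>r = p / q\<close> below. The case \<open>r = 0\<close> supplies an
    initial interval whose indicator is in \<open>X\<close>.\<close>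
  have level: "\<exists>m e. 0 < m \<and> 0 < e \<and> {0..<m} \<subseteq> I \<and> indicator {0..<m} \<in> elems X
      \<and> ennreal (r + e) * L \<le> fnorm X f"
    if f: "f \<in> elems X" and r: "0 \<le> r" "\<not> (AE x in lebesgue_on I. norm (f x) \<le> r)" for f r
  proof -
    have [measurable]: "f \<in> borel_measurable (lebesgue_on I)"
      using f elems_measurable by blast
    obtain E e m where E: "E \<in> sets (lebesgue_on I)" "0 < e" "\<And>x. x \<in> E \<Longrightarrow> r + e \<le> norm (f x)"
      "0 < m" "emeasure (lebesgue_on I) E = ennreal m"
      by (rule nonnull_bounded_subset[OF Is _ r(2)]) auto
    note init = initial[OF E(1,5) less_imp_le[OF E(4)]]
    have lev: "indicator E \<in> elems X" "ennreal (r + e) * fnorm X (indicator E) \<le> fnorm X f"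
      using indicator_level_norm[OF f E(1), of "r + e"] E(2,3) r(1) by auto
    have mm: "indicator {0..<m} \<in> elems X" "fnorm X (indicator {0..<m}) = fnorm X (indicator E)"
      using rearrangement_indicator[OF X lev(1) E(1) init(2)] init(3) by auto
    have "ennreal (r + e) * L \<le> ennreal (r + e) * fnorm X (indicator E)"
      using L_le[OF E(4) mm(1) init(1)] mm(2) by (intro mult_left_mono) auto
    then show ?thesis
      using E(2,4) mm(1) init(1) lev(2) order_trans by blast
  qed
  obtain f0 where f0: "f0 \<in> elems X" "\<not> (AE x in lebesgue_on I. f0 x = 0)"
    using nontrivial by blast
  then obtain m where m: "0 < m" "{0..<m} \<subseteq> I" "indicator {0..<m} \<in> elems X"
    using level[OF f0(1), of 0] by auto
  have "L < \<infinity>"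
    using L_le[OF m(1,3,2)] norm_finite[OF m(3)] by (rule le_less_trans)
  then obtain q where q: "0 < q" "L = ennreal q"
    using L(1) that[of "enn2real L"] by (simp add: enn2real_positive_iff)
  \<comment> \<open>Adding 1 to the norm makes positivity of \<open>D\<close> immediate.\<close>
  obtain D where D: "0 < D" "fnorm X (indicator {0..<m}) \<le> ennreal D"
    using norm_finite[OF m(3)] that[of "enn2real (fnorm X (indicator {0..<m})) + 1"]
    by (cases "fnorm X (indicator {0..<m})") (auto simp: add_nonneg_pos intro!: ennreal_leI)
  define B where "B n = {real n * m..<real (Suc n) * m} \<inter> I" for n
  have Bs: "B n \<in> sets (lebesgue_on I)" for n
    unfolding B_def using Is by (intro sets_on) auto
  have "emeasure (lebesgue_on I) (B n) \<le> ennreal m" for n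
  proof -
    have "emeasure (lebesgue_on I) (B n) = emeasure lebesgue (B n)"
      by (intro em) (auto simp: B_def)
    also have "\<dots> \<le> emeasure lebesgue {real n * m..<real (Suc n) * m}"
      unfolding B_def by (rule emeasure_mono) auto
    also have "\<dots> = ennreal m"
      using m(1) by (subst emeasure_completion) (auto simp: emeasure_lborel_Ico algebra_simps)
    finally show ?thesis .
  qed
  \<comment> \<open>On \<open>[0,1]\<close> blocks may be cut off or empty, so each is compared with
    the initial interval of its own measure \<open>k n\<close>, a subset of
    \<open>{0..<m}\<close>.\<close>
  then have "\<exists>k. 0 \<le> k \<and> k \<le> m \<and> emeasure (lebesgue_on I) (B n) = ennreal k" for n
    using m(1) by (auto simp: le_ennreal_iff)
  then obtain k where k: "\<And>n. 0 \<le> k n" "\<And>n. k n \<le> m" "\<And>n. emeasure (lebesgue_on I) (B n) = ennreal (k n)"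
    by metis
  have B: "indicator (B n) \<in> elems X" "fnorm X (indicator (B n)) \<le> ennreal D" for n
  proof -
    note init = initial[OF Bs k(3) k(1), of n]
    have "{0..<k n} \<subseteq> {0..<m}"
      using k(2)[of n] by auto
    note sub = indicator_subset[OF m(3) init(2) this]
    show "indicator (B n) \<in> elems X" "fnorm X (indicator (B n)) \<le> ennreal D"
      using rearrangement_indicator[OF X sub(1) init(2) Bs init(3)] sub(2) D(2) by auto
  qed
  have cover: "(\<Union>n. B n) = I"
  proof
    show "I \<subseteq> (\<Union>n. B n)"
    proof
      fix x assume x: "x \<in> I"
      then have "0 \<le> x / m" using Is m(1) by auto
      then have "real (nat \<lfloor>x / m\<rfloor>) \<le> x / m" "x / m < real (Suc (nat \<lfloor>x / m\<rfloor>))"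
        by (simp_all add: of_nat_floor) linarith
      then have "x \<in> B (nat \<lfloor>x / m\<rfloor>)"
        using x m(1) by (auto simp: B_def field_simps)
      then show "x \<in> (\<Union>n. B n)" by blast
    qed
  qed (auto simp: B_def)
  have bound: "AE x in lebesgue_on I. ennreal (norm (f x)) \<le> ennreal (1 / q) * fnorm X f" if f: "f \<in> elems X" for f
  proof -
    obtain p where p: "0 \<le> p" "fnorm X f = ennreal p"
      using norm_finite[OF f] by (cases "fnorm X f") auto
    have "AE x in lebesgue_on I. norm (f x) \<le> p / q"
    proof (rule ccontr)
      assume "\<not> ?thesis"
      then obtain e where e: "0 < e" "ennreal (p / q + e) * ennreal q \<le> ennreal p"
        using level[OF f, of "p / q"] p q by auto
      then have "ennreal ((p / q + e) * q) \<le> ennreal p"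
        using p q by (subst ennreal_mult) auto
      then have "(p / q + e) * q \<le> p"
        using p by (simp add: ennreal_le_iff)
      moreover have "(p / q + e) * q = p + e * q"
        using q(1) by (simp add: distrib_right)
      ultimately have "e * q \<le> 0"
        by simp
      then show False
        using mult_pos_pos[OF e(1) q(1)] by simp
    qed
    moreover have "ennreal (1 / q) * fnorm X f = ennreal (p / q)"
      unfolding p(2) using p(1) q(1) by (subst ennreal_mult[symmetric]) auto
    ultimately show ?thesis
      by (auto intro: ennreal_leI)
  qed
  have "block_bounded_space (lebesgue_on I) X (1 / q) D B"
    using q D Bs B cover bound by unfold_locales auto
  then show ?thesis by blast
qed

theorem theorem4p2p5:
  fixes F G :: "real \<Rightarrow> ennreal"
  assumes "young_function F" and "young_function G" and "1 < young_bound F"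
  shows "(\<forall>M \<in> {lebesgue_on {0..1}, lebesgue_on {0..}}.
            \<forall>X :: (real, 'k :: {real_normed_field, euclidean_space}) fun_space.
              rearrangement_invariant_space M X \<longrightarrow> \<not> nice_triple X F G \<longrightarrow>
              equal_with_equivalent_norms
                (multipliers M (calderon_lozanovskii M X F) (calderon_lozanovskii M X G))
                (calderon_lozanovskii M X (young_conj G 1 F))) \<and>
         (\<forall>X :: (nat, 'k) fun_space.
            let M = count_space UNIV in
              rearrangement_invariant_space M X \<longrightarrow>
              equal_with_equivalent_norms
                (multipliers M (calderon_lozanovskii M X F) (calderon_lozanovskii M X G))
                (calderon_lozanovskii M X (young_conj G 1 F)))"
proof (intro conjI ballI allI impI)
  fix M and X :: "(real, 'k) fun_space"
  assume M: "M \<in> {lebesgue_on {0..1}, lebesgue_on {0..}}"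
    and X: "rearrangement_invariant_space M X" and "\<not> nice_triple X F G"
  \<comment> \<open>Failure of niceness supplies the positive limit of the fundamental function, and
    with it the embedding into \<open>L\<^sub>\<infinity>\<close>.\<close>
  then have nonv: "nonvanishing_at_zero X"
    by (simp add: nice_triple_def)
  obtain I where I: "M = lebesgue_on I" "I \<in> {{0..1}, {0..}}"
    using M by auto
  obtain C D B where "block_bounded_space M X C D B"
    using block_bounded_space_lebesgue[OF X[unfolded I(1)] I(2) nonv] I(1) by blast
  then show "equal_with_equivalent_norms
      (multipliers M (calderon_lozanovskii M X F) (calderon_lozanovskii M X G))
      (calderon_lozanovskii M X (young_conj G 1 F))"
    using assms(1,2) by (rule block_bounded_space.multipliers_eq_cl_conj)
next
  fix X :: "(nat, 'k) fun_space"
  show "let M = count_space UNIV in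
      rearrangement_invariant_space M X \<longrightarrow>
      equal_with_equivalent_norms
        (multipliers M (calderon_lozanovskii M X F) (calderon_lozanovskii M X G))
        (calderon_lozanovskii M X (young_conj G 1 F))"
    unfolding Let_def
  proof
    assume "rearrangement_invariant_space (count_space UNIV) X"
    then obtain C D where "block_bounded_space (count_space UNIV) X C D (\<lambda>n. {n})"
      using block_bounded_space_count by blast
    then show "equal_with_equivalent_norms
        (multipliers (count_space UNIV) (calderon_lozanovskii (count_space UNIV) X F)
          (calderon_lozanovskii (count_space UNIV) X G))
        (calderon_lozanovskii (count_space UNIV) X (young_conj G 1 F))"
      using assms(1,2) by (rule block_bounded_space.multipliers_eq_cl_conj)
  qed
qed

end
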